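(* Let $x:M^n\to A^{n+1}$ be a non-degenerate hypersurface in the affine space $A^{n+1}$. Then $x$ is equiaffine isoparametric if and only if it is among a family of equiaffine parallel hypersurfaces.
   Context: $A^{n+1}$ is $\mathbb{R}^{n+1}$ with its canonical flat connection $d$ (componentwise differentiation) and the volume form $\mathrm{Vol}$ given by the determinant. A hypersurface is a smooth immersion $x:M^n\to A^{n+1}$ of a connected $n$-manifold. Indices $i,j,k,\dots$ run from $1$ to $n$. Affine invariants. For a local frame $\{e_1,\dots,e_n\}$ on $M$ write $x_i=e_i(x)$, $x_{ij}=e_j(e_i(x))$, $Y_i=e_i(Y)$, and choose a transversal field $e_{n+1}$ along $x$ with $\mathrm{Vol}(x_1,\dots,x_n,e_{n+1})=1$. Write $x_{ij}=\sum_k\Gamma_{ij}^k x_k+h_{ij}e_{n+1}$. The hypersurface is non-degenerate if $(h_{ij})$ is non-singular everywhere, and locally strongly convex if $(h_{ij})$ is definite everywhere; in the latter case the orientation is chosen so that $(h_{ij})$ is positive definite. With $H=|\det(h_{ij})|$, the Blaschke (affine) metric is $G=\sum G_{ij}\omega^i\omega^j$, $G_{ij}=H^{-1/(n+2)}h_{ij}$, where $\{\omega^i\}$ is the dual coframe (this does not depend on choices). The affine normal vector is $Y=\frac1n\Delta_G x$. The affine normal line at $u\in M$ is the line through $x(u)$ parallel to $Y(u)$. The affine shape operator $(B_i^j)$ is defined by $Y_i=-\sum_j B_i^j x_j$, and the affine mean curvature is $L_1=\frac1n\sum_i B_i^i$. Equiaffine parallel hypersurfaces. Let $x$ be locally strongly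 convex with affine normal $Y$ and let $\mu\in C^\infty(M)$. The hypersurface ${}^\mu x:=x+\mu Y$ is affine parallel to $x$ if ${}^\mu x$ is locally strongly convex and the tangent spaces ${}^\mu x_*(T_uM)$ and $x_*(T_uM)$ are parallel for all $u\in M$. It is equiaffine parallel to $x$ if it is affine parallel to $x$ and, in addition, the affine normal line of ${}^\mu x$ at $u$ is parallel to that of $x$ at $u$ for every $u\in M$. The hypersurface $x$ is among a family of equiaffine parallel hypersurfaces if $x$ is locally strongly convex and there is $\delta>0$ such that for every constant $\mu\in(-\delta,\delta)$ the hypersurface ${}^\mu x=x+\mu Y$ is equiaffine parallel to $x$. The hypersurface $x$ is equiaffine isoparametric if it is locally strongly convex and is among such a family all of whose members ${}^\mu x$, $\mu\in(-\delta,\delta)$, have constant affine mean curvature (as a function on $M$), for some $\delta>0$. *)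

theory Defs
  imports "HOL-Analysis.Analysis"
begin

section \<open>Smooth maps and smooth manifolds\<close>

text \<open>\<open>Ck_on k S f\<close>: \<open>f\<close> is of class \<open>C^k\<close> on the open set \<open>S\<close>.\<close>

primrec Ck_on ::
  "nat \<Rightarrow> 'a::euclidean_space set \<Rightarrow> ('a \<Rightarrow> 'b::real_normed_vector) \<Rightarrow> bool" where
  "Ck_on 0 S f \<longleftrightarrow> continuous_on S f"
| "Ck_on (Suc k) S f \<longleftrightarrow>
     (\<forall>u\<in>S. f differentiable (at u)) \<and>
     (\<forall>v. Ck_on k S (\<lambda>u. frechet_derivative f (at u) v))"

definition smooth_on ::
  "'a::euclidean_space set \<Rightarrow> ('a \<Rightarrow> 'b::real_normed_vector) \<Rightarrow> bool" where
  "smooth_on S f \<longleftrightarrow> (\<forall>k. Ck_on k S f)"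

text \<open>A chart is a domain together with a coordinate map; the values of the coordinate map
  outside the domain are irrelevant.\<close>

type_synonym ('m, 'n) chart = "'m set \<times> ('m \<Rightarrow> real ^ 'n)"

abbreviation dom_of :: "('m, 'n) chart \<Rightarrow> 'm set" where
  "dom_of \<equiv> fst"

abbreviation coord :: "('m, 'n) chart \<Rightarrow> 'm \<Rightarrow> real ^ 'n" where
  "coord \<equiv> snd"

definition coord_inv :: "('m, 'n) chart \<Rightarrow> real ^ 'n \<Rightarrow> 'm" where
  "coord_inv c = inv_into (dom_of c) (coord c)"

definition is_chart :: "('m::topological_space, 'n::finite) chart \<Rightarrow> bool" where
  "is_chart c \<longleftrightarrow>
     open (dom_of c) \<and> open (coord c ` dom_of c) \<and>
     homeomorphism (dom_of c) (coord c ` dom_of c) (coord c) (coord_inv c)"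

definition compatible_charts :: "('m, 'n::finite) chart \<Rightarrow> ('m, 'n) chart \<Rightarrow> bool" where
  "compatible_charts c d \<longleftrightarrow>
     smooth_on (coord c ` (dom_of c \<inter> dom_of d)) (coord d \<circ> coord_inv c) \<and>
     smooth_on (coord d ` (dom_of c \<inter> dom_of d)) (coord c \<circ> coord_inv d)"

text \<open>A smooth structure is given by its maximal atlas. In particular, every orientation
  reversal of a chart is again a chart of the atlas.\<close>

definition smooth_manifold ::
  "('m::{t2_space, second_countable_topology}, 'n::finite) chart set \<Rightarrow> bool" where
  "smooth_manifold \<A> \<longleftrightarrow>
     (\<forall>c\<in>\<A>. is_chart c) \<and>
     (\<Union>c\<in>\<A>. dom_of c) = UNIV \<and>
     (\<forall>c\<in>\<A>. \<forall>d\<in>\<A>. compatible_charts c d) \<and>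
     (\<forall>c. is_chart c \<and> (\<forall>d\<in>\<A>. compatible_charts c d) \<longrightarrow> c \<in> \<A>)"

definition smooth_map ::
  "('m, 'n::finite) chart set \<Rightarrow> ('m \<Rightarrow> 'b::real_normed_vector) \<Rightarrow> bool" where
  "smooth_map \<A> f \<longleftrightarrow> (\<forall>c\<in>\<A>. smooth_on (coord c ` dom_of c) (f \<circ> coord_inv c))"

text \<open>\<open>frame c i f\<close> is the function \<open>e_i(f)\<close> on the domain of \<open>c\<close>, where \<open>e_1, \<dots>, e_n\<close> is the
  coordinate frame of the chart \<open>c\<close>.\<close>

definition frame ::
  "('m, 'n::finite) chart \<Rightarrow> 'n \<Rightarrow> ('m \<Rightarrow> 'b::real_normed_vector) \<Rightarrow> 'm \<Rightarrow> 'b" where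
  "frame c i f p = frechet_derivative (f \<circ> coord_inv c) (at (coord c p)) (axis i 1)"


section \<open>Hypersurfaces\<close>

text \<open>For \<open>'n\<close> of cardinality \<open>n\<close>, the space \<open>A^{n+1}\<close> is \<open>real ^ 'n option\<close>: the index \<open>Some i\<close>
  stands for \<open>i \<in> {1, \<dots>, n}\<close> and \<open>None\<close> for \<open>n + 1\<close>. \<open>Vol X \<xi>\<close> is the determinant of
  \<open>(X_1, \<dots>, X_n, \<xi>)\<close>.\<close>

definition Vol :: "('n::finite \<Rightarrow> real ^ 'n option) \<Rightarrow> real ^ 'n option \<Rightarrow> real" where
  "Vol X \<xi> = det (\<chi> a. case a of Some i \<Rightarrow> X i | None \<Rightarrow> \<xi>)"

definition immersion ::
  "('m, 'n::finite) chart set \<Rightarrow> ('m \<Rightarrow> real ^ 'n option) \<Rightarrow> bool" where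
  "immersion \<A> x \<longleftrightarrow>
     smooth_map \<A> x \<and>
     (\<forall>c\<in>\<A>. \<forall>p\<in>dom_of c. inj (frechet_derivative (x \<circ> coord_inv c) (at (coord c p))))"

text \<open>\<open>sff c x p\<close> is the matrix \<open>(h_ij)\<close> at \<open>p\<close> for the coordinate frame of \<open>c\<close>. It does not depend
  on the vector \<open>\<xi> = e_{n+1}\<close>; see \<open>sff_eq_Vol\<close> below.\<close>

definition sff ::
  "('m, 'n::finite) chart \<Rightarrow> ('m \<Rightarrow> real ^ 'n option) \<Rightarrow> 'm \<Rightarrow> real ^ 'n ^ 'n" where
  "sff c x p = (\<chi> i j. THE h. \<exists>\<xi> \<Gamma>.
     Vol (\<lambda>k. frame c k x p) \<xi> = 1 \<and>
     frame c j (frame c i x) p = (\<Sum>k\<in>UNIV. \<Gamma> k *\<^sub>R frame c k x p) + h *\<^sub>R \<xi>)"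

definition nondegenerate ::
  "('m, 'n::finite) chart set \<Rightarrow> ('m \<Rightarrow> real ^ 'n option) \<Rightarrow> bool" where
  "nondegenerate \<A> x \<longleftrightarrow>
     immersion \<A> x \<and> (\<forall>c\<in>\<A>. \<forall>p\<in>dom_of c. invertible (sff c x p))"

definition pos_definite :: "real ^ 'n ^ 'n::finite \<Rightarrow> bool" where
  "pos_definite A \<longleftrightarrow> (\<forall>v. v \<noteq> 0 \<longrightarrow> v \<bullet> (A *v v) > 0)"

definition locally_strongly_convex ::
  "('m, 'n::finite) chart set \<Rightarrow> ('m \<Rightarrow> real ^ 'n option) \<Rightarrow> bool" where
  "locally_strongly_convex \<A> x \<longleftrightarrow>
     immersion \<A> x \<and>
     (\<forall>c\<in>\<A>. \<forall>p\<in>dom_of c. pos_definite (sff c x p) \<or> pos_definite (- sff c x p))"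

definition tangent_space ::
  "('m, 'n::finite) chart set \<Rightarrow> ('m \<Rightarrow> real ^ 'n option) \<Rightarrow> 'm \<Rightarrow> (real ^ 'n option) set" where
  "tangent_space \<A> x p =
     (\<Union>c\<in>{c\<in>\<A>. p \<in> dom_of c}. range (frechet_derivative (x \<circ> coord_inv c) (at (coord c p))))"


section \<open>Affine invariants of locally strongly convex hypersurfaces\<close>

text \<open>A chart around \<open>p\<close> that is positively oriented for the orientation determined by \<open>x\<close>, that
  is, the one making \<open>(h_ij)\<close> positive definite. The invariants below do not depend on which of
  these charts is picked.\<close>

definition oriented_chart ::
  "('m, 'n::finite) chart set \<Rightarrow> ('m \<Rightarrow> real ^ 'n option) \<Rightarrow> 'm \<Rightarrow> ('m, 'n) chart" where
  "oriented_chart \<A> x p =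
     (SOME c. c \<in> \<A> \<and> p \<in> dom_of c \<and> (\<forall>q\<in>dom_of c. pos_definite (sff c x q)))"

definition Blaschke ::
  "('m, 'n::finite) chart \<Rightarrow> ('m \<Rightarrow> real ^ 'n option) \<Rightarrow> 'm \<Rightarrow> real ^ 'n ^ 'n" where
  "Blaschke c x p =
     (\<bar>det (sff c x p)\<bar> powr (- 1 / (real CARD('n) + 2))) *\<^sub>R sff c x p"

text \<open>The Laplacian of a metric \<open>g\<close> in the coordinates of \<open>c\<close>, acting componentwise on
  vector-valued functions:
  \<open>\<Delta> f = |det g|^{-1/2} \<Sum>_i \<partial>_i (|det g|^{1/2} \<Sum>_j g^{ij} \<partial>_j f)\<close>.\<close>

definition laplacian ::
  "('m, 'n::finite) chart \<Rightarrow> ('m \<Rightarrow> real ^ 'n ^ 'n) \<Rightarrow> ('m \<Rightarrow> 'b::real_normed_vector)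
    \<Rightarrow> 'm \<Rightarrow> 'b" where
  "laplacian c g f p =
     (1 / sqrt \<bar>det (g p)\<bar>) *\<^sub>R
       (\<Sum>i\<in>UNIV. frame c i
          (\<lambda>q. sqrt \<bar>det (g q)\<bar> *\<^sub>R (\<Sum>j\<in>UNIV. (matrix_inv (g q) $ i $ j) *\<^sub>R frame c j f q)) p)"

definition affine_normal ::
  "('m, 'n::finite) chart set \<Rightarrow> ('m \<Rightarrow> real ^ 'n option) \<Rightarrow> 'm \<Rightarrow> real ^ 'n option" where
  "affine_normal \<A> x p =
     (let c = oriented_chart \<A> x p
      in (1 / real CARD('n)) *\<^sub>R laplacian c (Blaschke c x) x p)"

definition affine_normal_line ::
  "('m, 'n::finite) chart set \<Rightarrow> ('m \<Rightarrow> real ^ 'n option) \<Rightarrow> 'm \<Rightarrow> (real ^ 'n option) set" where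
  "affine_normal_line \<A> x p = {x p + t *\<^sub>R affine_normal \<A> x p | t. True}"

definition shape_operator ::
  "('m, 'n::finite) chart set \<Rightarrow> ('m, 'n) chart \<Rightarrow> ('m \<Rightarrow> real ^ 'n option) \<Rightarrow> 'm
    \<Rightarrow> real ^ 'n ^ 'n" where
  "shape_operator \<A> c x p = (THE B. \<forall>i.
     frame c i (affine_normal \<A> x) p = - (\<Sum>j\<in>UNIV. (B $ i $ j) *\<^sub>R frame c j x p))"

definition affine_mean_curvature ::
  "('m, 'n::finite) chart set \<Rightarrow> ('m \<Rightarrow> real ^ 'n option) \<Rightarrow> 'm \<Rightarrow> real" where
  "affine_mean_curvature \<A> x p =
     (1 / real CARD('n)) * trace (shape_operator \<A> (oriented_chart \<A> x p) x p)"


section \<open>Equiaffine parallel hypersurfaces\<close>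

definition shifted ::
  "('m, 'n::finite) chart set \<Rightarrow> ('m \<Rightarrow> real ^ 'n option) \<Rightarrow> ('m \<Rightarrow> real) \<Rightarrow> 'm
    \<Rightarrow> real ^ 'n option" where
  "shifted \<A> x \<mu> p = x p + \<mu> p *\<^sub>R affine_normal \<A> x p"

definition parallel_hypersurface ::
  "('m, 'n::finite) chart set \<Rightarrow> ('m \<Rightarrow> real ^ 'n option) \<Rightarrow> ('m \<Rightarrow> real) \<Rightarrow> bool" where
  "parallel_hypersurface \<A> x \<mu> \<longleftrightarrow>
     locally_strongly_convex \<A> x \<and> smooth_map \<A> \<mu> \<and>
     locally_strongly_convex \<A> (shifted \<A> x \<mu>) \<and>
     (\<forall>p. affine_parallel (tangent_space \<A> (shifted \<A> x \<mu>) p) (tangent_space \<A> x p))"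

definition equiaffine_parallel_hypersurface ::
  "('m, 'n::finite) chart set \<Rightarrow> ('m \<Rightarrow> real ^ 'n option) \<Rightarrow> ('m \<Rightarrow> real) \<Rightarrow> bool" where
  "equiaffine_parallel_hypersurface \<A> x \<mu> \<longleftrightarrow>
     parallel_hypersurface \<A> x \<mu> \<and>
     (\<forall>p. affine_parallel (affine_normal_line \<A> (shifted \<A> x \<mu>) p) (affine_normal_line \<A> x p))"

definition equiaffine_parallel_family ::
  "('m, 'n::finite) chart set \<Rightarrow> ('m \<Rightarrow> real ^ 'n option) \<Rightarrow> real \<Rightarrow> bool" where
  "equiaffine_parallel_family \<A> x \<delta> \<longleftrightarrow>
     locally_strongly_convex \<A> x \<and>
     (\<forall>t\<in>{-\<delta><..<\<delta>}. equiaffine_parallel_hypersurface \<A> x (\<lambda>_. t))"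

definition among_equiaffine_parallel_family ::
  "('m, 'n::finite) chart set \<Rightarrow> ('m \<Rightarrow> real ^ 'n option) \<Rightarrow> bool" where
  "among_equiaffine_parallel_family \<A> x \<longleftrightarrow> (\<exists>\<delta>>0. equiaffine_parallel_family \<A> x \<delta>)"

definition equiaffine_isoparametric ::
  "('m, 'n::finite) chart set \<Rightarrow> ('m \<Rightarrow> real ^ 'n option) \<Rightarrow> bool" where
  "equiaffine_isoparametric \<A> x \<longleftrightarrow>
     locally_strongly_convex \<A> x \<and>
     (\<exists>\<delta>>0. equiaffine_parallel_family \<A> x \<delta> \<and>
        (\<forall>t\<in>{-\<delta><..<\<delta>}.
           affine_mean_curvature \<A> (shifted \<A> x (\<lambda>_. t)) constant_on UNIV))"


section \<open>Independence of the second fundamental form from the transversal vector\<close>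

lemma linear_Vol: "linear (Vol X)"
proof -
  have *: "Vol X = (\<lambda>\<xi>. det (\<chi> a. if a = None then \<xi> else case a of Some i \<Rightarrow> X i | None \<Rightarrow> 0))"
    unfolding Vol_def by (intro ext arg_cong[where f = det]) (auto simp: vec_eq_iff split: option.split)
  show ?thesis
    unfolding * by (intro linearI) (simp_all only: det_row_add det_row_mul scalar_mult_eq_scaleR[symmetric] real_scaleR_def)
qed

lemma Vol_tangent: "Vol X (X k) = 0"
  unfolding Vol_def
  by (rule det_identical_rows[of None "Some k"]) (auto simp: row_def vec_eq_iff)

lemma Vol_decomp:
  assumes "Vol X \<xi> = 1" and "v = (\<Sum>k\<in>UNIV. \<Gamma> k *\<^sub>R X k) + h *\<^sub>R \<xi>"
  shows "Vol X v = h"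
  using assms
  by (simp add: linear_add[OF linear_Vol] linear_sum[OF linear_Vol] linear_cmul[OF linear_Vol]
      Vol_tangent)

lemma Vol_decomp_exists:
  assumes "Vol X \<xi> = 1"
  shows "\<exists>\<Gamma>. v = (\<Sum>k\<in>UNIV. \<Gamma> k *\<^sub>R X k) + Vol X v *\<^sub>R \<xi>"
proof -
  define A where "A = (\<chi> a. case a of Some i \<Rightarrow> X i | None \<Rightarrow> \<xi>)"
  have "invertible A"
    using assms by (simp add: invertible_det_nz Vol_def A_def)
  then obtain A' where "A' ** A = mat 1"
    by (auto simp: invertible_def)
  then have "v = (v v* A') v* A"
    by (simp add: vector_matrix_mul_assoc)
  then obtain w where w: "v = w v* A"
    by blast
  have "v = (\<Sum>a\<in>UNIV. w $ a *\<^sub>R A $ a)"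
    unfolding w by (simp add: vec_eq_iff vector_matrix_mult_def mult.commute)
  also have "\<dots> = (\<Sum>k\<in>UNIV. w $ Some k *\<^sub>R X k) + w $ None *\<^sub>R \<xi>"
    by (simp add: UNIV_option_conv sum.reindex A_def add.commute)
  finally have *: "v = (\<Sum>k\<in>UNIV. w $ Some k *\<^sub>R X k) + w $ None *\<^sub>R \<xi>" .
  from * show ?thesis
    unfolding Vol_decomp[OF assms *] by (intro exI[of _ "\<lambda>k. w $ Some k"])
qed

lemma sff_eq_Vol:
  assumes "Vol (\<lambda>k. frame c k x p) \<xi> = 1"
  shows "sff c x p $ i $ j = Vol (\<lambda>k. frame c k x p) (frame c j (frame c i x) p)"
proof -
  have "(THE h. \<exists>\<xi> \<Gamma>. Vol (\<lambda>k. frame c k x p) \<xi> = 1 \<and>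
          frame c j (frame c i x) p = (\<Sum>k\<in>UNIV. \<Gamma> k *\<^sub>R frame c k x p) + h *\<^sub>R \<xi>) =
        Vol (\<lambda>k. frame c k x p) (frame c j (frame c i x) p)"
  proof (rule the_equality)
    show "\<exists>\<xi> \<Gamma>. Vol (\<lambda>k. frame c k x p) \<xi> = 1 \<and>
        frame c j (frame c i x) p = (\<Sum>k\<in>UNIV. \<Gamma> k *\<^sub>R frame c k x p) +
          Vol (\<lambda>k. frame c k x p) (frame c j (frame c i x) p) *\<^sub>R \<xi>"
      using assms Vol_decomp_exists[OF assms] by blast
  next
    fix h
    assume "\<exists>\<xi> \<Gamma>. Vol (\<lambda>k. frame c k x p) \<xi> = 1 \<and>
        frame c j (frame c i x) p = (\<Sum>k\<in>UNIV. \<Gamma> k *\<^sub>R frame c k x p) + h *\<^sub>R \<xi>"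
    then obtain \<xi> \<Gamma> where "Vol (\<lambda>k. frame c k x p) \<xi> = 1"
      and "frame c j (frame c i x) p = (\<Sum>k\<in>UNIV. \<Gamma> k *\<^sub>R frame c k x p) + h *\<^sub>R \<xi>"
      by blast
    from Vol_decomp[OF this]
    show "h = Vol (\<lambda>k. frame c k x p) (frame c j (frame c i x) p)" by (rule sym)
  qed
  then show ?thesis
    by (simp add: sff_def)
qed

end

theory Submission
  imports Defs
begin

text \<open>
Write \<open>\<nu>\<close> for the conormal \<open>w \<mapsto> Vol (x_1, \<dots>, x_n, w)\<close>, \<open>h_ij = \<nu>(x_ij)\<close>, and
\<open>\<rho> = (det h)^{1/(n+2)}\<close>. On a chart with \<open>h\<close> positive definite, the affine normal \<open>Y\<close> is the only
vector field with \<open>\<nu>(Y) = \<rho>\<close> and tangential derivatives. This makes \<open>Y\<close> independent of the chart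
and yields a shape operator \<open>B\<close>. For \<open>x + t Y\<close> the coordinate frame, \<open>\<nu>\<close> and \<open>h\<close> are multiplied by
\<open>I - t B\<close>, \<open>det (I - t B)\<close> and \<open>det (I - t B) (I - t B)\<close> respectively.

If the affine normal \<open>Y_t\<close> of \<open>x + t Y\<close> is \<open>f_t Y\<close>, then comparing transversal components of its
derivatives shows that \<open>f_t\<close> is locally constant, hence constant on the connected manifold, and
comparing \<open>\<nu>(Y_t)\<close> gives \<open>det (I - t B) = f_t^{-(n+2)}\<close>. So \<open>D(t) = det (I - t B)\<close> is the same
function of \<open>t\<close> at every point, and \<open>n L_1 = tr (f_t B (I - t B)^{-1}) = - f_t D'(t) / D(t)\<close> is
constant.
\<close>

section \<open>Calculus of smooth maps\<close>

text \<open>The obstacle is that \<open>affine_normal\<close> picks a chart by choice at each point,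
  so not even its continuity is visible from the definition. It has to be replaced locally by the
  smooth formula of one fixed chart, and the orientation behind that choice has to be compared
  between members of the family. The exponent in the relation for f_t comes from two countings. With
  D = det (I - t B), pairing with the conormal gives rho_t = D f_t rho, while det h_t = D^(n+1) det
  h. Since rho^(n+2) = det h, this says (D f_t)^(n+2) = D^(n+1). Each Y_t is built separately, and
  the proof establishes no regularity of f_t in t. Differentiability in t comes from D, a polynomial
  in t at each point. Jacobi's formula for the pencil I - t B then produces the trace in the mean
  curvature directly, so no principal curvatures are discussed.\<close>

lemma frechet_derivativeI:
  "f differentiable (at u) \<Longrightarrow> (f has_derivative frechet_derivative f (at u)) (at u)"
  by (simp add: frechet_derivative_works)

text \<open>On an open set derivatives only see nearby values. This is used constantly, because
  \<open>coord_inv c\<close> is arbitrary outside the image of the chart.\<close>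

lemma Ck_on_cong:
  fixes f g :: "'a::euclidean_space \<Rightarrow> 'b::real_normed_vector"
  assumes "open S" "\<And>u. u \<in> S \<Longrightarrow> f u = g u" "Ck_on k S f"
  shows "Ck_on k S g"
  using assms(2,3)
proof (induction k arbitrary: f g)
  case 0
  from 0(2) show ?case unfolding Ck_on.simps by (rule continuous_on_eq) (rule 0(1))
next
  case (Suc k)
  have diff: "f differentiable (at u)" if "u \<in> S" for u
    using Suc.prems(2) that by simp
  have d: "(g has_derivative frechet_derivative f (at u)) (at u)" if "u \<in> S" for u
    by (rule has_derivative_transform_within_open[OF frechet_derivativeI[OF diff[OF that]] assms(1) that])
      (rule Suc.prems(1))
  have eq: "frechet_derivative g (at u) = frechet_derivative f (at u)" if "u \<in> S" for u
    using frechet_derivative_at[OF d[OF that]] by (rule sym)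
  have "Ck_on k S (\<lambda>u. frechet_derivative g (at u) v)" for v
    by (rule Suc.IH[of "\<lambda>u. frechet_derivative f (at u) v"]) (use Suc.prems eq in \<open>auto\<close>)
  then have "\<forall>v. Ck_on k S (\<lambda>u. frechet_derivative g (at u) v)" ..
  moreover have "\<forall>u\<in>S. g differentiable (at u)"
    using differentiableI[OF d] ..
  ultimately show ?case unfolding Ck_on.simps(2) by (rule conjI[rotated])
qed

lemma Ck_on_subset: "Ck_on k S f \<Longrightarrow> T \<subseteq> S \<Longrightarrow> Ck_on k T f"
  by (induction k arbitrary: f) (auto intro: continuous_on_subset)

lemma Ck_on_SucD: "Ck_on (Suc k) S f \<Longrightarrow> Ck_on k S f"
proof (induction k arbitrary: f)
  case 0
  then show ?case
    by (auto intro!: continuous_at_imp_continuous_on differentiable_imp_continuous_within)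
next
  case (Suc k)
  from Suc.prems have "f differentiable (at u)" if "u \<in> S" for u
    using that unfolding Ck_on.simps(2)[of "Suc k"] by blast
  moreover from Suc.prems have "Ck_on (Suc k) S (\<lambda>u. frechet_derivative f (at u) v)" for v
    unfolding Ck_on.simps(2)[of "Suc k"] by blast
  ultimately show ?case
    using Suc.IH unfolding Ck_on.simps(2)[of k] by blast
qed

text \<open>The definition of \<open>Ck_on\<close> speaks of \<open>frechet_derivative\<close>; this
  rule admits any derivative produced by the calculus rules. The inductive closure proofs below go
  through it.\<close>

lemma Ck_on_SucI:
  assumes S: "open S" and d: "\<And>u. u \<in> S \<Longrightarrow> (f has_derivative f' u) (at u)"
    and k: "\<And>v. Ck_on k S (\<lambda>u. f' u v)"
  shows "Ck_on (Suc k) S f"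
proof -
  have eq: "frechet_derivative f (at u) = f' u" if "u \<in> S" for u
    using frechet_derivative_at[OF d[OF that]] by simp
  have "Ck_on k S (\<lambda>u. frechet_derivative f (at u) v)" for v
    by (rule Ck_on_cong[OF S _ k[of v]]) (simp add: eq)
  then have "\<forall>v. Ck_on k S (\<lambda>u. frechet_derivative f (at u) v)" ..
  moreover have "f differentiable (at u)" if "u \<in> S" for u
    using d[OF that] by (rule differentiableI)
  then have "\<forall>u\<in>S. f differentiable (at u)" ..
  ultimately show ?thesis unfolding Ck_on.simps(2) by (rule conjI[rotated])
qed

lemma Ck_on_Suc_has_derivative:
  "Ck_on (Suc k) S f \<Longrightarrow> u \<in> S \<Longrightarrow> (f has_derivative frechet_derivative f (at u)) (at u)"
  by (rule frechet_derivativeI) (rule Ck_on.simps(2)[THEN iffD1, THEN conjunct1, THEN bspec])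

lemma Ck_on_Suc_frechet_derivative:
  "Ck_on (Suc k) S f \<Longrightarrow> Ck_on k S (\<lambda>u. frechet_derivative f (at u) v)"
  by (rule Ck_on.simps(2)[THEN iffD1, THEN conjunct2, THEN spec])

lemmas Ck_on_SucDs = Ck_on_Suc_has_derivative Ck_on_Suc_frechet_derivative Ck_on_SucD

lemma Ck_on_const [simp]: "Ck_on k S (\<lambda>u. c)"
  by (induction k arbitrary: c) auto

lemma Ck_on_bounded_linear_comp:
  assumes S: "open S" and L: "bounded_linear L" and "Ck_on k S f"
  shows "Ck_on k S (\<lambda>u. L (f u))"
  using assms(3)
proof (induction k arbitrary: f)
  case 0
  then show ?case by (simp add: bounded_linear.continuous_on[OF L])
next
  case (Suc k)
  show ?case
  proof (rule Ck_on_SucI[OF S])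
    show "((\<lambda>u. L (f u)) has_derivative (\<lambda>v. L (frechet_derivative f (at u) v))) (at u)" if "u \<in> S" for u
      by (rule bounded_linear.has_derivative[OF L Ck_on_SucDs(1)[OF Suc.prems that]])
    show "Ck_on k S (\<lambda>u. L (frechet_derivative f (at u) v))" for v
      by (rule Suc.IH[OF Ck_on_SucDs(2)[OF Suc.prems]])
  qed
qed

lemma Ck_on_add:
  assumes S: "open S" and "Ck_on k S f" "Ck_on k S g"
  shows "Ck_on k S (\<lambda>u. f u + g u)"
  using assms(2,3)
proof (induction k arbitrary: f g)
  case 0
  then show ?case by (simp add: continuous_on_add)
next
  case (Suc k)
  show ?case
  proof (rule Ck_on_SucI[OF S])
    show "((\<lambda>u. f u + g u) has_derivative
        (\<lambda>v. frechet_derivative f (at u) v + frechet_derivative g (at u) v)) (at u)" if "u \<in> S" for u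
      by (rule has_derivative_add[OF Ck_on_SucDs(1)[OF Suc.prems(1) that] Ck_on_SucDs(1)[OF Suc.prems(2) that]])
    show "Ck_on k S (\<lambda>u. frechet_derivative f (at u) v + frechet_derivative g (at u) v)" for v
      by (rule Suc.IH[OF Ck_on_SucDs(2)[OF Suc.prems(1)] Ck_on_SucDs(2)[OF Suc.prems(2)]])
  qed
qed

text \<open>In the product rule one factor stays undifferentiated, so the induction needs that
  factor at the lower order as well; \<open>Ck_on_SucD\<close> supplies it.\<close>

lemma Ck_on_bilinear:
  assumes S: "open S" and B: "bounded_bilinear pr" and "Ck_on k S f" "Ck_on k S g"
  shows "Ck_on k S (\<lambda>u. pr (f u) (g u))"
  using assms(3,4)
proof (induction k arbitrary: f g)
  case 0
  then show ?case by (simp add: bounded_bilinear.continuous_on[OF B])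
next
  case (Suc k)
  show ?case
  proof (rule Ck_on_SucI[OF S])
    show "((\<lambda>u. pr (f u) (g u)) has_derivative
        (\<lambda>v. pr (f u) (frechet_derivative g (at u) v) + pr (frechet_derivative f (at u) v) (g u))) (at u)"
      if "u \<in> S" for u
      by (rule bounded_bilinear.FDERIV[OF B Ck_on_SucDs(1)[OF Suc.prems(1) that]
            Ck_on_SucDs(1)[OF Suc.prems(2) that]])
    show "Ck_on k S (\<lambda>u. pr (f u) (frechet_derivative g (at u) v) +
        pr (frechet_derivative f (at u) v) (g u))" for v
      by (rule Ck_on_add[OF S Suc.IH[OF Ck_on_SucDs(3)[OF Suc.prems(1)] Ck_on_SucDs(2)[OF Suc.prems(2)]]
            Suc.IH[OF Ck_on_SucDs(2)[OF Suc.prems(1)] Ck_on_SucDs(3)[OF Suc.prems(2)]]])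
  qed
qed

lemma Ck_on_mult:
  fixes f g :: "'a::euclidean_space \<Rightarrow> real"
  shows "open S \<Longrightarrow> Ck_on k S f \<Longrightarrow> Ck_on k S g \<Longrightarrow> Ck_on k S (\<lambda>u. f u * g u)"
  by (rule Ck_on_bilinear[OF _ bounded_bilinear_mult])

text \<open>The derivative of 1/f is a product of 1/f, f' and 1/f, so the induction on
  \<open>k\<close> closes for one fixed \<open>f\<close>.\<close>

lemma Ck_on_inverse:
  fixes f :: "'a::euclidean_space \<Rightarrow> real"
  assumes S: "open S" and nz: "\<And>u. u \<in> S \<Longrightarrow> f u \<noteq> 0" and "Ck_on k S f"
  shows "Ck_on k S (\<lambda>u. inverse (f u))"
  using assms(3)
proof (induction k)
  case 0
  then show ?case using nz by (auto intro: continuous_on_inverse)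
next
  case (Suc k)
  show ?case
  proof (rule Ck_on_SucI[OF S])
    fix u assume u: "u \<in> S"
    show "((\<lambda>u. inverse (f u)) has_derivative
        (\<lambda>v. (- 1) * (inverse (f u) * (frechet_derivative f (at u) v * inverse (f u))))) (at u)"
      using Deriv.has_derivative_inverse[of f u, OF nz[OF u] Ck_on_SucDs(1)[OF Suc.prems u]]
      by (simp add: mult.assoc)
  next
    fix v
    show "Ck_on k S (\<lambda>u. (- 1) * (inverse (f u) * (frechet_derivative f (at u) v * inverse (f u))))"
      using Suc.prems by (intro Ck_on_mult[OF S Ck_on_const]
          Ck_on_mult[OF S Suc.IH[OF Ck_on_SucDs(3)]] Ck_on_mult[OF S Ck_on_SucDs(2)]
          Suc.IH[OF Ck_on_SucDs(3)])
  qed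
qed

lemma Ck_on_powr:
  fixes f :: "'a::euclidean_space \<Rightarrow> real"
  assumes S: "open S" and nz: "\<And>u. u \<in> S \<Longrightarrow> f u > 0" and "Ck_on k S f"
  shows "Ck_on k S (\<lambda>u. f u powr a)"
  using assms(3)
\<comment> \<open>The derivative carries the exponent \<open>a - 1\<close>, hence the generalisation
  over \<open>a\<close>.\<close>
proof (induction k arbitrary: a)
  case 0
  then show ?case using nz by (auto intro!: continuous_on_powr continuous_on_const) fastforce
next
  case (Suc k)
  show ?case
  proof (rule Ck_on_SucI[OF S])
    fix u assume u: "u \<in> S"
    have "((\<lambda>x. x powr a) has_derivative (\<lambda>h. a * f u powr (a - 1) * h)) (at (f u))"
      using has_real_derivative_powr[OF nz[OF u], of a] unfolding has_field_derivative_def .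
    from diff_chain_at[OF Ck_on_SucDs(1)[OF Suc.prems u] this]
    show "((\<lambda>u. f u powr a) has_derivative (\<lambda>v. a * f u powr (a - 1) * frechet_derivative f (at u) v)) (at u)"
      by (simp add: o_def)
  next
    fix v
    show "Ck_on k S (\<lambda>u. a * f u powr (a - 1) * frechet_derivative f (at u) v)"
      by (rule Ck_on_mult[OF S Ck_on_mult[OF S Ck_on_const Suc.IH[OF Ck_on_SucDs(3)[OF Suc.prems]]]
            Ck_on_SucDs(2)[OF Suc.prems]])
  qed
qed

text \<open>For linear \<open>R\<close> the derivative of the composite in direction
  \<open>v\<close> is a derivative of \<open>f\<close> in the constant direction \<open>R v\<close>,
  again precomposed with \<open>R\<close>, so the induction hypothesis applies at once.\<close>

lemma Ck_on_linear_precomp: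
  fixes R :: "'a::euclidean_space \<Rightarrow> 'c::euclidean_space"
  assumes T: "open T" and R: "bounded_linear R" and sub: "R ` T \<subseteq> S" and "Ck_on k S f"
  shows "Ck_on k T (\<lambda>u. f (R u))"
  using assms(4)
proof (induction k arbitrary: f)
  case 0
  then show ?case
    using continuous_on_compose2[of S f T R] sub linear_continuous_on[OF R] by auto
next
  case (Suc k)
  show ?case
  proof (rule Ck_on_SucI[OF T])
    fix u assume u: "u \<in> T"
    then have "R u \<in> S" using sub by blast
    from diff_chain_at[OF bounded_linear_imp_has_derivative[OF R] Ck_on_SucDs(1)[OF Suc.prems this]]
    show "((\<lambda>u. f (R u)) has_derivative (\<lambda>v. frechet_derivative f (at (R u)) (R v))) (at u)"
      by (simp add: o_def)
  next
    fix v
    show "Ck_on k T (\<lambda>u. frechet_derivative f (at (R u)) (R v))"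
      by (rule Suc.IH[OF Ck_on_SucDs(2)[OF Suc.prems]])
  qed
qed

section \<open>Closure properties of smooth maps\<close>

lemma smooth_on_cong:
  "open S \<Longrightarrow> (\<And>u. u \<in> S \<Longrightarrow> f u = g u) \<Longrightarrow> smooth_on S f \<Longrightarrow> smooth_on S g"
  unfolding smooth_on_def by (rule allI, rule Ck_on_cong[of S f], simp_all)

lemma smooth_on_subset: "smooth_on S f \<Longrightarrow> T \<subseteq> S \<Longrightarrow> smooth_on T f"
  unfolding smooth_on_def by (rule allI, rule Ck_on_subset, simp_all)

lemma smooth_on_const: "smooth_on S (\<lambda>u. c)"
  by (simp add: smooth_on_def)

lemma smooth_on_bounded_linear_comp:
  "open S \<Longrightarrow> bounded_linear L \<Longrightarrow> smooth_on S f \<Longrightarrow> smooth_on S (\<lambda>u. L (f u))"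
  unfolding smooth_on_def by (rule allI, rule Ck_on_bounded_linear_comp[of S L _ f], simp_all)

lemma smooth_on_bilinear:
  "open S \<Longrightarrow> bounded_bilinear pr \<Longrightarrow> smooth_on S f \<Longrightarrow> smooth_on S g \<Longrightarrow> smooth_on S (\<lambda>u. pr (f u) (g u))"
  unfolding smooth_on_def by (rule allI, rule Ck_on_bilinear[of S pr _ f g], simp_all)

lemmas smooth_on_mult = smooth_on_bilinear[OF _ bounded_bilinear_mult]
lemmas smooth_on_scaleR = smooth_on_bilinear[OF _ bounded_bilinear_scaleR]
lemmas smooth_on_inner = smooth_on_bilinear[OF _ bounded_bilinear_inner]

lemma smooth_on_add:
  "open S \<Longrightarrow> smooth_on S f \<Longrightarrow> smooth_on S g \<Longrightarrow> smooth_on S (\<lambda>u. f u + g u)"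
  unfolding smooth_on_def by (rule allI, rule Ck_on_add[of S _ f g], simp_all)

lemma smooth_on_sum:
  assumes "open S" "\<And>i. i \<in> I \<Longrightarrow> smooth_on S (f i)"
  shows "smooth_on S (\<lambda>u. \<Sum>i\<in>I. f i u)"
  using assms(2)
  by (induction I rule: infinite_finite_induct) (simp_all add: smooth_on_const smooth_on_add[OF assms(1)])

lemma smooth_on_prod:
  fixes f :: "'i \<Rightarrow> 'a::euclidean_space \<Rightarrow> real"
  assumes "open S" "\<And>i. i \<in> I \<Longrightarrow> smooth_on S (f i)"
  shows "smooth_on S (\<lambda>u. \<Prod>i\<in>I. f i u)"
  using assms(2)
  by (induction I rule: infinite_finite_induct) (simp_all add: smooth_on_const smooth_on_mult[OF assms(1)])

lemma smooth_on_inverse: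
  fixes f :: "'a::euclidean_space \<Rightarrow> real"
  shows "open S \<Longrightarrow> (\<And>u. u \<in> S \<Longrightarrow> f u \<noteq> 0) \<Longrightarrow> smooth_on S f \<Longrightarrow> smooth_on S (\<lambda>u. inverse (f u))"
  unfolding smooth_on_def by (rule allI, rule Ck_on_inverse[of S f], simp_all)

lemma smooth_on_powr:
  fixes f :: "'a::euclidean_space \<Rightarrow> real"
  shows "open S \<Longrightarrow> (\<And>u. u \<in> S \<Longrightarrow> f u > 0) \<Longrightarrow> smooth_on S f \<Longrightarrow> smooth_on S (\<lambda>u. f u powr a)"
  unfolding smooth_on_def by (rule allI, rule Ck_on_powr[of S f], simp_all)

lemma smooth_on_linear_precomp:
  fixes R :: "'a::euclidean_space \<Rightarrow> 'c::euclidean_space"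
  shows "open T \<Longrightarrow> bounded_linear R \<Longrightarrow> R ` T \<subseteq> S \<Longrightarrow> smooth_on S f \<Longrightarrow> smooth_on T (\<lambda>u. f (R u))"
  unfolding smooth_on_def by (rule allI, rule Ck_on_linear_precomp[of T R S _ f], simp_all)

lemma smooth_on_frechet_derivative:
  "smooth_on S f \<Longrightarrow> smooth_on S (\<lambda>u. frechet_derivative f (at u) v)"
  unfolding smooth_on_def by (metis Ck_on.simps(2))

lemma smooth_on_imp_differentiable: "smooth_on S f \<Longrightarrow> u \<in> S \<Longrightarrow> f differentiable (at u)"
  unfolding smooth_on_def by (metis Ck_on.simps(2))

lemma smooth_on_imp_continuous_on: "smooth_on S f \<Longrightarrow> continuous_on S f"
  unfolding smooth_on_def by (metis Ck_on.simps(1))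

section \<open>Partial derivatives and determinants\<close>

lemma second_difference_bound:
  fixes f :: "'a::real_normed_vector \<Rightarrow> real"
  assumes S: "open S" and u: "u \<in> S"
    and f: "\<And>y. y \<in> S \<Longrightarrow> (f has_derivative f' y) (at y)"
    and L: "((\<lambda>y. f' y v) has_derivative L) (at u)" and e: "e > 0"
  shows "\<exists>d>0. \<forall>s. 0 < s \<and> s < d \<longrightarrow>
    \<bar>f (u + s *\<^sub>R v + s *\<^sub>R w) - f (u + s *\<^sub>R v) - f (u + s *\<^sub>R w) + f u - s\<^sup>2 * L w\<bar> \<le> e * s\<^sup>2"
proof -
  \<comment> \<open>The linearisation errors at the two points used below are (e/K) s (|v| + |w|)
    and (e/K) s |v|. This \<open>K\<close> makes their sum at most e s; the summand 1 keeps it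
    positive for v = w = 0.\<close>
  define K where "K = 2 * norm v + norm w + 1"
  have K: "K > 0" unfolding K_def by (simp add: add_nonneg_pos)
  obtain r where r: "r > 0" "ball u r \<subseteq> S"
    using S u by (meson open_contains_ball)
  obtain d where d: "d > 0"
    "\<And>y. norm (y - u) < d \<Longrightarrow> norm (f' y v - f' u v - L (y - u)) \<le> (e / K) * norm (y - u)"
    using L e K unfolding has_derivative_at_alt by (meson divide_pos_pos)
  have linL: "linear L" using L has_derivative_linear by blast
  show ?thesis
  proof (intro exI[of _ "min r d / K"] conjI allI impI)
    show "0 < min r d / K" using r d K by simp
  next
    fix s :: real
    assume s: "0 < s \<and> s < min r d / K"
    then have sK: "s * K < min r d" using K by (simp add: field_simps)
    have bd: "norm (q *\<^sub>R v + t *\<^sub>R w) \<le> s * (norm v + norm w)" if "0 \<le> q" "q \<le> s" "0 \<le> t" "t \<le> s" for q t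
    proof -
      have "norm (q *\<^sub>R v + t *\<^sub>R w) \<le> q * norm v + t * norm w"
        using norm_triangle_ineq[of "q *\<^sub>R v" "t *\<^sub>R w"] that by simp
      also have "\<dots> \<le> s * norm v + s * norm w"
        using that by (intro add_mono mult_right_mono) auto
      finally show ?thesis by (simp add: algebra_simps)
    qed
    have lt: "s * (norm v + norm w) < min r d"
    proof -
      have "s * (norm v + norm w) \<le> s * K" unfolding K_def using s by (intro mult_left_mono) auto
      then show ?thesis using sK by linarith
    qed
    have inS: "u + q *\<^sub>R v + t *\<^sub>R w \<in> S" if "0 \<le> q" "q \<le> s" "0 \<le> t" "t \<le> s" for q t
    proof -
      have "dist (u + q *\<^sub>R v + t *\<^sub>R w) u = norm (q *\<^sub>R v + t *\<^sub>R w)"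
        by (simp add: dist_norm add.assoc)
      then have "u + q *\<^sub>R v + t *\<^sub>R w \<in> ball u r"
        unfolding mem_ball dist_commute[of u] using bd[OF that] lt by linarith
      then show ?thesis using r by blast
    qed
    \<comment> \<open>The second difference is \<open>\<phi> s - \<phi> 0\<close>. The mean value
      theorem along \<open>v\<close> turns it into \<open>s\<close> times a difference of first
      derivatives in direction \<open>v\<close>, which \<open>L\<close> evaluates up to a small
      error.\<close>
    define \<phi> where "\<phi> q = f (u + q *\<^sub>R v + s *\<^sub>R w) - f (u + q *\<^sub>R v)" for q
    define \<phi>' where "\<phi>' q = f' (u + q *\<^sub>R v + s *\<^sub>R w) v - f' (u + q *\<^sub>R v) v" for q
    have line: "((\<lambda>q. f (c + q *\<^sub>R v)) has_real_derivative f' (c + q *\<^sub>R v) v) (at q)"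
      if "c + q *\<^sub>R v \<in> S" for c q
    proof -
      have 1: "((\<lambda>q. c + q *\<^sub>R v) has_derivative (\<lambda>h. h *\<^sub>R v)) (at q)"
        by (auto intro!: derivative_eq_intros)
      have "linear (f' (c + q *\<^sub>R v))" using f[OF that] has_derivative_linear by blast
      then have "(\<lambda>h. f' (c + q *\<^sub>R v) (h *\<^sub>R v)) = (*) (f' (c + q *\<^sub>R v) v)"
        by (auto simp: linear_cmul)
      then show ?thesis using diff_chain_at[OF 1 f[OF that]]
        by (simp add: has_field_derivative_def o_def)
    qed
    have "\<exists>z>0. z < s \<and> \<phi> s - \<phi> 0 = (s - 0) * \<phi>' z"
    proof (rule MVT2)
      show "0 < s" using s by simp
      fix q assume q: "0 \<le> q" "q \<le> s"
      have "((\<lambda>q. f ((u + s *\<^sub>R w) + q *\<^sub>R v)) has_real_derivative f' ((u + s *\<^sub>R w) + q *\<^sub>R v) v) (at q)"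
        using inS[of q s] q s by (intro line) (auto simp: algebra_simps)
      moreover have "((\<lambda>q. f (u + q *\<^sub>R v)) has_real_derivative f' (u + q *\<^sub>R v) v) (at q)"
        using inS[of q 0] q s by (intro line) auto
      ultimately show "(\<phi> has_real_derivative \<phi>' q) (at q)"
        unfolding \<phi>_def \<phi>'_def by (auto intro!: DERIV_diff simp: add_ac)
    qed
    then obtain z where z: "0 < z" "z < s" "\<phi> s - \<phi> 0 = s * \<phi>' z" by auto
    let ?a = "z *\<^sub>R v + s *\<^sub>R w" and ?b = "z *\<^sub>R v"
    have na: "norm ?a \<le> s * (norm v + norm w)" using bd[of z s] z by auto
    have nb: "norm ?b \<le> s * norm v" using z by (auto intro: mult_right_mono)
    have nb': "norm ?b \<le> s * (norm v + norm w)" using bd[of z 0] z by auto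
    have A: "\<bar>f' (u + ?a) v - f' u v - L ?a\<bar> \<le> (e / K) * (s * (norm v + norm w))"
    proof -
      have "\<bar>f' (u + ?a) v - f' u v - L ?a\<bar> \<le> (e / K) * norm ?a"
        using d(2)[of "u + ?a"] na lt by simp
      also have "\<dots> \<le> (e / K) * (s * (norm v + norm w))"
        by (rule mult_left_mono[OF na]) (use e K in simp)
      finally show ?thesis .
    qed
    have B: "\<bar>f' (u + ?b) v - f' u v - L ?b\<bar> \<le> (e / K) * (s * norm v)"
    proof -
      have "\<bar>f' (u + ?b) v - f' u v - L ?b\<bar> \<le> (e / K) * norm ?b"
        using d(2)[of "u + ?b"] nb' lt by simp
      also have "\<dots> \<le> (e / K) * (s * norm v)"
        by (rule mult_left_mono[OF nb]) (use e K in simp)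
      finally show ?thesis .
    qed
    have "L ?a - L ?b = s * L w"
      using linL by (simp add: linear_add linear_cmul)
    then have "\<phi>' z - s * L w = (f' (u + ?a) v - f' u v - L ?a) - (f' (u + ?b) v - f' u v - L ?b)"
      unfolding \<phi>'_def by (simp add: add.assoc)
    then have "\<bar>\<phi>' z - s * L w\<bar> \<le> (e / K) * (s * (norm v + norm w)) + (e / K) * (s * norm v)"
      using A B by linarith
    also have "\<dots> \<le> (e / K) * (s * K)"
    proof -
      have "(e / K) * (s * (norm v + norm w)) + (e / K) * (s * norm v) = (e / K) * (s * (2 * norm v + norm w))"
        by (simp add: algebra_simps)
      also have "\<dots> \<le> (e / K) * (s * K)"
        unfolding K_def[symmetric] using e K s by (intro mult_left_mono) (auto simp: K_def)
      finally show ?thesis .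
    qed
    also have "\<dots> = e * s" using K by simp
    finally have fin: "\<bar>\<phi>' z - s * L w\<bar> \<le> e * s" .
    have "f (u + s *\<^sub>R v + s *\<^sub>R w) - f (u + s *\<^sub>R v) - f (u + s *\<^sub>R w) + f u - s\<^sup>2 * L w
        = s * (\<phi>' z - s * L w)"
      using z(3) unfolding \<phi>_def by (simp add: power2_eq_square algebra_simps)
    then have "\<bar>f (u + s *\<^sub>R v + s *\<^sub>R w) - f (u + s *\<^sub>R v) - f (u + s *\<^sub>R w) + f u - s\<^sup>2 * L w\<bar>
        = s * \<bar>\<phi>' z - s * L w\<bar>" using s by (simp add: abs_mult)
    also have "\<dots> \<le> s * (e * s)" using fin s by (intro mult_left_mono) auto
    finally show "\<bar>f (u + s *\<^sub>R v + s *\<^sub>R w) - f (u + s *\<^sub>R v) - f (u + s *\<^sub>R w) + f u - s\<^sup>2 * L w\<bar> \<le> e * s\<^sup>2"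
      by (simp add: power2_eq_square mult_ac)
  qed
qed

text \<open>The second difference is symmetric in \<open>v\<close> and \<open>w\<close>, and the
  preceding bound, used in both orders, compares it with \<open>L w\<close> and with
  \<open>M v\<close>. With \<open>e\<close> a third of the gap, two errors of size \<open>e\<close>
  cannot bridge it.\<close>

lemma second_derivative_symmetric_real:
  fixes f :: "'a::real_normed_vector \<Rightarrow> real"
  assumes S: "open S" and u: "u \<in> S"
    and f: "\<And>y. y \<in> S \<Longrightarrow> (f has_derivative f' y) (at y)"
    and L: "((\<lambda>y. f' y v) has_derivative L) (at u)" and M: "((\<lambda>y. f' y w) has_derivative M) (at u)"
  shows "L w = M v"
proof (rule ccontr)
  assume "L w \<noteq> M v"
  define e where "e = \<bar>L w - M v\<bar> / 3"
  have e: "e > 0" using \<open>L w \<noteq> M v\<close> by (simp add: e_def)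
  obtain d1 where d1: "d1 > 0" "\<forall>s. 0 < s \<and> s < d1 \<longrightarrow>
    \<bar>f (u + s *\<^sub>R v + s *\<^sub>R w) - f (u + s *\<^sub>R v) - f (u + s *\<^sub>R w) + f u - s\<^sup>2 * L w\<bar> \<le> e * s\<^sup>2"
    using second_difference_bound[OF S u f L e, of w] by blast
  obtain d2 where d2: "d2 > 0" "\<forall>s. 0 < s \<and> s < d2 \<longrightarrow>
    \<bar>f (u + s *\<^sub>R w + s *\<^sub>R v) - f (u + s *\<^sub>R w) - f (u + s *\<^sub>R v) + f u - s\<^sup>2 * M v\<bar> \<le> e * s\<^sup>2"
    using second_difference_bound[OF S u f M e, of v] by blast
  define s where "s = min d1 d2 / 2"
  have s: "0 < s" "s < d1" "s < d2" using d1 d2 by (auto simp: s_def)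
  have swap: "u + s *\<^sub>R w + s *\<^sub>R v = u + s *\<^sub>R v + s *\<^sub>R w" by (simp add: add_ac)
  have "\<bar>f (u + s *\<^sub>R v + s *\<^sub>R w) - f (u + s *\<^sub>R w) - f (u + s *\<^sub>R v) + f u - s\<^sup>2 * M v\<bar> \<le> e * s\<^sup>2"
    using d2(2)[rule_format, of s] s unfolding swap by blast
  moreover have "\<bar>f (u + s *\<^sub>R v + s *\<^sub>R w) - f (u + s *\<^sub>R v) - f (u + s *\<^sub>R w) + f u - s\<^sup>2 * L w\<bar> \<le> e * s\<^sup>2"
    using d1(2)[rule_format, of s] s by blast
  ultimately have "\<bar>s\<^sup>2 * L w - s\<^sup>2 * M v\<bar> \<le> 2 * (e * s\<^sup>2)"
    by linarith
  then have "s\<^sup>2 * \<bar>L w - M v\<bar> \<le> s\<^sup>2 * (2 * e)"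
    unfolding right_diff_distrib[symmetric] abs_mult by (simp add: mult_ac)
  then have "\<bar>L w - M v\<bar> \<le> 2 * e" using s(1) by simp
  then show False using e by (simp add: e_def)
qed

lemma second_derivative_symmetric:
  fixes f :: "'a::euclidean_space \<Rightarrow> 'b::euclidean_space"
  assumes S: "open S" and u: "u \<in> S" and f: "smooth_on S f"
  shows "frechet_derivative (\<lambda>y. frechet_derivative f (at y) v) (at u) w =
         frechet_derivative (\<lambda>y. frechet_derivative f (at y) w) (at u) v"
proof (rule euclidean_eqI)
  fix b :: 'b
  assume "b \<in> Basis"
  have d: "((\<lambda>y. f y \<bullet> b) has_derivative (\<lambda>v. frechet_derivative f (at y) v \<bullet> b)) (at y)" if "y \<in> S" for y
    by (rule has_derivative_inner_left[OF frechet_derivativeI[OF smooth_on_imp_differentiable[OF f that]]])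
  have dd: "((\<lambda>y. frechet_derivative f (at y) v \<bullet> b) has_derivative
     (\<lambda>w. frechet_derivative (\<lambda>y. frechet_derivative f (at y) v) (at u) w \<bullet> b)) (at u)" for v
    by (rule has_derivative_inner_left[OF frechet_derivativeI[OF
          smooth_on_imp_differentiable[OF smooth_on_frechet_derivative[OF f] u]]])
  show "frechet_derivative (\<lambda>y. frechet_derivative f (at y) v) (at u) w \<bullet> b =
         frechet_derivative (\<lambda>y. frechet_derivative f (at y) w) (at u) v \<bullet> b"
    by (rule second_derivative_symmetric_real[OF S u d dd dd])
qed

section \<open>Derivatives of determinants\<close>

lemma has_derivative_det:
  fixes A :: "'a::real_normed_vector \<Rightarrow> real ^ 'n::finite ^ 'n"
  assumes "\<And>i j. ((\<lambda>u. A u $ i $ j) has_derivative (\<lambda>v. D v $ i $ j)) (at u)"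
  shows "((\<lambda>u. det (A u)) has_derivative
    (\<lambda>v. \<Sum>r\<in>UNIV. det (\<chi> i. if i = r then D v $ r else A u $ i))) (at u)"
proof -
  let ?P = "{p. p permutes (UNIV :: 'n set)}"
  have 1: "((\<lambda>u. det (A u)) has_derivative
     (\<lambda>v. \<Sum>p\<in>?P. of_int (sign p) * (\<Sum>i\<in>UNIV. D v $ i $ p i * (\<Prod>j\<in>UNIV - {i}. A u $ j $ p j)))) (at u)"
    unfolding det_def
    by (intro has_derivative_sum has_derivative_mult_right has_derivative_prod assms)
  have row: "det (\<chi> i. if i = r then D v $ r else A u $ i) =
      (\<Sum>p\<in>?P. of_int (sign p) * (D v $ r $ p r * (\<Prod>j\<in>UNIV - {r}. A u $ j $ p j)))"
    for r v
    unfolding det_def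
  proof (intro sum.cong refl arg_cong2[where f = "(*)"])
    fix p
    let ?M = "(\<chi> i. if i = r then D v $ r else A u $ i)"
    have "(\<Prod>i\<in>UNIV. ?M $ i $ p i) = ?M $ r $ p r * (\<Prod>i\<in>UNIV - {r}. ?M $ i $ p i)"
      by (rule prod.remove) auto
    also have "(\<Prod>i\<in>UNIV - {r}. ?M $ i $ p i) = (\<Prod>j\<in>UNIV - {r}. A u $ j $ p j)"
      by (intro prod.cong) auto
    finally show "(\<Prod>i\<in>UNIV. ?M $ i $ p i) = D v $ r $ p r * (\<Prod>j\<in>UNIV - {r}. A u $ j $ p j)"
      by simp
  qed
  have "(\<Sum>r\<in>UNIV. det (\<chi> i. if i = r then D v $ r else A u $ i)) =
    (\<Sum>p\<in>?P. of_int (sign p) * (\<Sum>i\<in>UNIV. D v $ i $ p i * (\<Prod>j\<in>UNIV - {i}. A u $ j $ p j)))" for v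
    unfolding row sum_distrib_left by (rule sum.swap)
  then show ?thesis using 1 by simp
qed

text \<open>Row \<open>r\<close> of \<open>C ** A\<close> is a combination of the rows of
  \<open>A\<close>, of which only the \<open>r\<close>-th, with coefficient
  \<open>C $ r $ r\<close>, does not repeat another row. Together with
  \<open>has_derivative_det\<close> this is Jacobi's formula for a derivative of the form C A,
  without adjugates.\<close>

lemma sum_det_replace_row:
  fixes A C :: "real ^ 'n::finite ^ 'n"
  shows "(\<Sum>r\<in>UNIV. det (\<chi> i. if i = r then (C ** A) $ r else A $ i)) = trace C * det A"
proof -
  let ?R = "\<lambda>r (a :: real^'n). \<chi> i. if i = r then a else A $ i"
  have "det (?R r ((C ** A) $ r)) = C $ r $ r * det A" for r
  proof -
    have "(C ** A) $ r = (\<Sum>m\<in>UNIV. C $ r $ m *s A $ m)"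
      by (simp add: vec_eq_iff matrix_matrix_mult_def)
    then have "det (?R r ((C ** A) $ r)) = (\<Sum>m\<in>UNIV. det (?R r (C $ r $ m *s A $ m)))"
      using det_linear_row_sum[of UNIV r "\<lambda>_ m. C $ r $ m *s A $ m" "\<lambda>i. A $ i"] by (simp only: finite)
    also have "\<dots> = (\<Sum>m\<in>UNIV. C $ r $ m * det (?R r (A $ m)))"
      by (intro sum.cong refl det_row_mul)
    also have "\<dots> = (\<Sum>m\<in>UNIV. if m = r then C $ r $ r * det A else 0)"
    proof (intro sum.cong refl)
      fix m
      show "C $ r $ m * det (?R r (A $ m)) = (if m = r then C $ r $ r * det A else 0)"
      proof (cases "m = r")
        case True
        have "?R r (A $ m) = A" using True by (simp add: vec_eq_iff)
        then show ?thesis using True by (simp only: simp_thms if_True)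
      next
        case False
        then have "det (?R r (A $ m)) = 0"
          by (intro det_identical_rows[of m r]) (auto simp: row_def vec_eq_iff)
        then show ?thesis using False by simp
      qed
    qed
    finally show ?thesis by simp
  qed
  then show ?thesis by (simp add: trace_def sum_distrib_right)
qed

text \<open>Coordinate counterpart of \<open>frame\<close>: after composition with the inverse of a
  chart, all computations take place on open subsets of \<open>real ^ 'n\<close>.\<close>

definition pd :: "'n \<Rightarrow> (real ^ 'n::finite \<Rightarrow> 'b::real_normed_vector) \<Rightarrow> real ^ 'n \<Rightarrow> 'b" where
  "pd i F u = frechet_derivative F (at u) (axis i 1)"

lemma pd_eqI: "(F has_derivative F') (at u) \<Longrightarrow> pd i F u = F' (axis i 1)"
  unfolding pd_def using frechet_derivative_at by metis

text \<open>\<open>frechet_derivative\<close> is a choice among the derivatives at \<open>u\<close>,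
  and both functions have the same derivatives there; so the choices coincide, differentiable or
  not.\<close>

lemma pd_cong:
  assumes "open S" "u \<in> S" "\<And>y. y \<in> S \<Longrightarrow> F y = G y"
  shows "pd i F u = pd i G u"
proof -
  have "(F has_derivative D) (at u) \<longleftrightarrow> (G has_derivative D) (at u)" for D
  proof
    show "(G has_derivative D) (at u)" if "(F has_derivative D) (at u)"
      by (rule has_derivative_transform_within_open[OF that assms(1,2)]) (rule assms(3))
    show "(F has_derivative D) (at u)" if "(G has_derivative D) (at u)"
      by (rule has_derivative_transform_within_open[OF that assms(1,2)]) (rule assms(3)[symmetric])
  qed
  then show ?thesis unfolding pd_def frechet_derivative_def by simp
qed

lemma differentiable_cong_open:
  assumes "open S" "u \<in> S" "\<And>y. y \<in> S \<Longrightarrow> F y = G y" "F differentiable (at u)"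
  shows "G differentiable (at u)"
  by (rule differentiableI[OF has_derivative_transform_within_open[OF
          frechet_derivativeI[OF assms(4)] assms(1,2)]]) (rule assms(3))

lemma pd_const [simp]: "pd i (\<lambda>u. c) u = 0"
  by (simp add: pd_def)

lemma pd_bilinear:
  assumes "bounded_bilinear pr" "F differentiable (at u)" "G differentiable (at u)"
  shows "pd i (\<lambda>u. pr (F u) (G u)) u = pr (F u) (pd i G u) + pr (pd i F u) (G u)"
  using bounded_bilinear.FDERIV[OF assms(1) frechet_derivativeI[OF assms(2)] frechet_derivativeI[OF assms(3)]]
  by (subst pd_eqI) (auto simp: pd_def)

lemmas pd_inner = pd_bilinear[OF bounded_bilinear_inner]
lemmas pd_mult = pd_bilinear[OF bounded_bilinear_mult]
lemmas pd_scaleR = pd_bilinear[OF bounded_bilinear_scaleR]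

lemma pd_add:
  assumes "F differentiable (at u)" "G differentiable (at u)"
  shows "pd i (\<lambda>u. F u + G u) u = pd i F u + pd i G u"
  using has_derivative_add[OF frechet_derivativeI[OF assms(1)] frechet_derivativeI[OF assms(2)]]
  by (subst pd_eqI) (auto simp: pd_def)

lemma pd_sum:
  assumes "\<And>k. k \<in> I \<Longrightarrow> F k differentiable (at u)"
  shows "pd i (\<lambda>u. \<Sum>k\<in>I. F k u) u = (\<Sum>k\<in>I. pd i (F k) u)"
  using has_derivative_sum[of I F "\<lambda>k. frechet_derivative (F k) (at u)", OF frechet_derivativeI[OF assms]]
  by (subst pd_eqI) (auto simp: pd_def)

lemma vec_eq_sum_axis: "(v :: real ^ 'n::finite) = (\<Sum>j\<in>UNIV. v $ j *\<^sub>R axis j 1)"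
  by (simp add: vec_eq_iff axis_def if_distrib cong: if_cong)

lemma frechet_derivative_eq_sum_pd:
  assumes "F differentiable (at u)"
  shows "frechet_derivative F (at u) v = (\<Sum>j\<in>UNIV. v $ j *\<^sub>R pd j F u)"
proof -
  have "linear (frechet_derivative F (at u))" using assms linear_frechet_derivative by blast
  then show ?thesis
    by (subst vec_eq_sum_axis) (simp add: linear_sum linear_cmul pd_def)
qed

lemma pd_compose:
  assumes "\<phi> differentiable (at u)" "F differentiable (at (\<phi> u))"
  shows "pd i (\<lambda>u. F (\<phi> u)) u = (\<Sum>j\<in>UNIV. pd i \<phi> u $ j *\<^sub>R pd j F (\<phi> u))"
proof -
  have "pd i (F \<circ> \<phi>) u = (frechet_derivative F (at (\<phi> u)) \<circ> frechet_derivative \<phi> (at u)) (axis i 1)"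
    by (rule pd_eqI[OF diff_chain_at[OF frechet_derivativeI[OF assms(1)] frechet_derivativeI[OF assms(2)]]])
  then show ?thesis
    unfolding o_def frechet_derivative_eq_sum_pd[OF assms(2)] pd_def[of i \<phi>] .
qed

lemma pd_commute:
  fixes F :: "real ^ 'n::finite \<Rightarrow> 'b::euclidean_space"
  assumes "open S" "u \<in> S" "smooth_on S F"
  shows "pd i (pd j F) u = pd j (pd i F) u"
  unfolding pd_def[abs_def] by (rule second_derivative_symmetric[OF assms])

lemma smooth_on_pd: "smooth_on S F \<Longrightarrow> smooth_on S (pd i F)"
  unfolding pd_def[abs_def] by (rule smooth_on_frechet_derivative)

text \<open>Jacobi's formula with the logarithmic derivative \<open>C\<close> as a parameter. It is
  the connection matrix of a frame in \<open>apolarity\<close>, and the derivative of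
  \<open>h\<close> times its inverse in \<open>pd_conormal_anormal\<close>.\<close>

lemma pd_det:
  fixes A :: "real ^ 'm::finite \<Rightarrow> real ^ 'n::finite ^ 'n"
  assumes d: "\<And>i j. (\<lambda>u. A u $ i $ j) differentiable (at u)"
    and C: "\<And>i j. pd k (\<lambda>u. A u $ i $ j) u = (C ** A u) $ i $ j"
  shows "pd k (\<lambda>u. det (A u)) u = trace C * det (A u)"
proof -
  let ?D = "\<lambda>v. \<chi> i j. frechet_derivative (\<lambda>u. A u $ i $ j) (at u) v"
  have "((\<lambda>u. A u $ i $ j) has_derivative (\<lambda>v. ?D v $ i $ j)) (at u)" for i j
    using frechet_derivativeI[OF d] by simp
  from has_derivative_det[OF this]
  have "pd k (\<lambda>u. det (A u)) u = (\<Sum>r\<in>UNIV. det (\<chi> i. if i = r then ?D (axis k 1) $ r else A u $ i))"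
    by (rule pd_eqI)
  moreover have "?D (axis k 1) = C ** A u"
    using C by (simp add: vec_eq_iff pd_def)
  ultimately show ?thesis by (simp only: sum_det_replace_row)
qed

lemma smooth_on_det:
  fixes A :: "'a::euclidean_space \<Rightarrow> real ^ 'n::finite ^ 'n"
  assumes "open S" "\<And>i j. smooth_on S (\<lambda>u. A u $ i $ j)"
  shows "smooth_on S (\<lambda>u. det (A u))"
  unfolding det_def
  by (intro smooth_on_sum[OF assms(1)] smooth_on_mult[OF assms(1)] smooth_on_const smooth_on_prod[OF assms(1)] assms(2))

lemma matrix_inv:
  fixes A :: "real ^ 'n::finite ^ 'n"
  assumes "invertible A"
  shows "A ** matrix_inv A = mat 1" "matrix_inv A ** A = mat 1"
  using someI_ex[OF assms[unfolded invertible_def]] unfolding matrix_inv_def by auto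

text \<open>Cramer's rule for column \<open>j\<close> of the inverse. Quotients of polynomials in
  the entries make the smoothness of the inverse evident.\<close>

lemma matrix_inv_entry:
  fixes A :: "real ^ 'n::finite ^ 'n"
  assumes "det A \<noteq> 0"
  shows "matrix_inv A $ i $ j = det (\<chi> r s. if s = i then axis j 1 $ r else A $ r $ s) * inverse (det A)"
proof -
  have "invertible A" using assms by (simp add: invertible_det_nz)
  then have "A ** matrix_inv A = mat 1" by (rule matrix_inv)
  then have "A *v (matrix_inv A *v axis j 1) = axis j 1" by (simp add: matrix_vector_mul_assoc)
  then have "matrix_inv A *v axis j 1 = (\<chi> k. det (\<chi> i s. if s = k then axis j 1 $ i else A $ i $ s) / det A)"
    using cramer[OF assms] by blast
  then have "(matrix_inv A *v axis j 1) $ i = det (\<chi> r s. if s = i then axis j 1 $ r else A $ r $ s) / det A"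
    by simp
  then show ?thesis by (simp add: matrix_vector_mul_component column_def matrix_vector_mult_basis divide_inverse)
qed

lemma smooth_on_matrix_inv:
  fixes A :: "'a::euclidean_space \<Rightarrow> real ^ 'n::finite ^ 'n"
  assumes S: "open S" and sm: "\<And>i j. smooth_on S (\<lambda>u. A u $ i $ j)" and nz: "\<And>u. u \<in> S \<Longrightarrow> det (A u) \<noteq> 0"
  shows "smooth_on S (\<lambda>u. matrix_inv (A u) $ i $ j)"
proof (rule smooth_on_cong[OF S])
  show "det (\<chi> r s. if s = i then axis j 1 $ r else A u $ r $ s) * inverse (det (A u)) = matrix_inv (A u) $ i $ j"
    if "u \<in> S" for u
    using matrix_inv_entry[OF nz[OF that]] by simp
  have "smooth_on S (\<lambda>u. (\<chi> r s. if s = i then axis j 1 $ r else A u $ r $ s) $ a $ b)" for a b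
    by (cases "b = i") (simp_all add: smooth_on_const sm)
  then show "smooth_on S (\<lambda>u. det (\<chi> r s. if s = i then axis j 1 $ r else A u $ r $ s) * inverse (det (A u)))"
    by (intro smooth_on_mult[OF S] smooth_on_inverse[OF S] smooth_on_det[OF S] nz sm)
qed

section \<open>Conormal and second fundamental form of a parametrised hypersurface\<close>

text \<open>The matrix behind the left side is the block matrix diag(J, 1) times the one behind
  \<open>Vol X w\<close>. Instead of block determinants, the proof reduces \<open>J\<close> by
  elementary operations. \<open>X\<close> is quantified inside the induction because a swap of
  columns of \<open>J\<close> is absorbed by renumbering \<open>X\<close>.\<close>

lemma Vol_matrix_rows:
  fixes X :: "'n::finite \<Rightarrow> real ^ 'n option" and J :: "real ^ 'n ^ 'n"
  shows "Vol (\<lambda>k. \<Sum>j\<in>UNIV. J $ k $ j *\<^sub>R X j) w = det J * Vol X w"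
proof -
  have "\<forall>X. Vol (\<lambda>k. \<Sum>j\<in>UNIV. J $ k $ j *\<^sub>R X j) w = det J * Vol X w"
  proof (induction J rule: induct_matrix_row_operations)
    case zero_row: (1 A i)
    show ?case
    proof
      fix X :: "'n \<Rightarrow> real ^ 'n option"
      have "A $ i $ j = 0" for j using zero_row by (simp add: row_def vec_eq_iff)
      then have "Vol (\<lambda>k. \<Sum>j\<in>UNIV. A $ k $ j *\<^sub>R X j) w = 0"
        unfolding Vol_def by (intro det_zero_row[of "Some i"]) (simp add: row_def vec_eq_iff)
      moreover have "det A = 0" using zero_row by (rule det_zero_row)
      ultimately show "Vol (\<lambda>k. \<Sum>j\<in>UNIV. A $ k $ j *\<^sub>R X j) w = det A * Vol X w" by simp
    qed
  next
    case diagonal: (2 A)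
    show ?case
    proof
      fix X :: "'n \<Rightarrow> real ^ 'n option"
      have 1: "(\<Sum>j\<in>UNIV. A $ k $ j *\<^sub>R X j) = A $ k $ k *\<^sub>R X k" for k
      proof -
        have "(\<Sum>j\<in>UNIV. A $ k $ j *\<^sub>R X j) = (\<Sum>j\<in>UNIV. if j = k then A $ k $ j *\<^sub>R X j else 0)"
          by (rule sum.cong) (auto simp: diagonal)
        then show ?thesis by simp
      qed
      let ?c = "\<lambda>a. case a of Some i \<Rightarrow> A $ i $ i | None \<Rightarrow> 1"
      have "(\<chi> a. case a of Some i \<Rightarrow> A $ i $ i *\<^sub>R X i | None \<Rightarrow> w)
          = (\<chi> a. ?c a *s (case a of Some i \<Rightarrow> X i | None \<Rightarrow> w))"
        by (simp add: vec_eq_iff split: option.split)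
      then have "Vol (\<lambda>k. A $ k $ k *\<^sub>R X k) w = prod ?c UNIV * Vol X w"
        unfolding Vol_def using det_rows_mul[of ?c "\<lambda>a. case a of Some i \<Rightarrow> X i | None \<Rightarrow> w"] by simp
      moreover have "prod ?c UNIV = (\<Prod>i\<in>UNIV. A $ i $ i)"
        by (simp add: UNIV_option_conv prod.reindex)
      moreover have "det A = (\<Prod>i\<in>UNIV. A $ i $ i)"
        using diagonal by (rule det_diagonal)
      ultimately show "Vol (\<lambda>k. \<Sum>j\<in>UNIV. A $ k $ j *\<^sub>R X j) w = det A * Vol X w"
        unfolding 1 by simp
    qed
  next
    case swap_cols: (3 A m n)
    let ?t = "Transposition.transpose m n"
    show ?case
    proof
      fix X :: "'n \<Rightarrow> real ^ 'n option"
      have bij: "bij_betw ?t UNIV UNIV" by simp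
      have "(\<Sum>j\<in>UNIV. A $ k $ ?t j *\<^sub>R X j) = (\<Sum>j\<in>UNIV. A $ k $ j *\<^sub>R X (?t j))" for k
        using sum.reindex_bij_betw[OF bij, of "\<lambda>j. A $ k $ j *\<^sub>R X (?t j)"] by simp
      then have "Vol (\<lambda>k. \<Sum>j\<in>UNIV. (\<chi> i j. A $ i $ ?t j) $ k $ j *\<^sub>R X j) w = det A * Vol (\<lambda>k. X (?t k)) w"
        using swap_cols(1) by simp
      also have "Vol (\<lambda>k. X (?t k)) w = - Vol X w"
      proof -
        let ?s = "Transposition.transpose (Some m) (Some n)"
        let ?M = "\<chi> a. case a of Some i \<Rightarrow> X i | None \<Rightarrow> w"
        have "(\<chi> a. case a of Some i \<Rightarrow> X (?t i) | None \<Rightarrow> w) = (\<chi> a. ?M $ ?s a)"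
          by (auto simp: vec_eq_iff Transposition.transpose_def split: option.split)
        moreover have "?s permutes UNIV" by (rule permutes_swap_id) auto
        ultimately show ?thesis
          unfolding Vol_def using det_permute_rows[of ?s ?M] swap_cols(2) by (simp add: sign_swap_id)
      qed
      also have "det A * (- Vol X w) = det (\<chi> i j. A $ i $ ?t j) * Vol X w"
        using det_permute_columns[of ?t A] swap_cols(2) permutes_swap_id[of m UNIV n] by (simp add: sign_swap_id)
      finally show "Vol (\<lambda>k. \<Sum>j\<in>UNIV. (\<chi> i j. A $ i $ ?t j) $ k $ j *\<^sub>R X j) w
        = det (\<chi> i j. A $ i $ ?t j) * Vol X w" .
    qed
  next
    case row_op: (4 A m n c)
    let ?B = "\<chi> i. if i = m then row m A + c *\<^sub>R row n A else row i A"
    show ?case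
    proof
      fix X :: "'n \<Rightarrow> real ^ 'n option"
      define Y where "Y k = (\<Sum>j\<in>UNIV. A $ k $ j *\<^sub>R X j)" for k
      let ?M = "\<chi> a. case a of Some i \<Rightarrow> Y i | None \<Rightarrow> w"
      have "(\<Sum>j\<in>UNIV. ?B $ k $ j *\<^sub>R X j) = (if k = m then Y m + c *\<^sub>R Y n else Y k)" for k
        by (simp add: Y_def row_def scaleR_add_left sum.distrib scaleR_sum_right)
      then have "Vol (\<lambda>k. \<Sum>j\<in>UNIV. ?B $ k $ j *\<^sub>R X j) w = Vol (\<lambda>k. if k = m then Y m + c *\<^sub>R Y n else Y k) w"
        by (simp only:)
      also have "\<dots> =
          det (\<chi> a. if a = Some m then row (Some m) ?M + c *s row (Some n) ?M else row a ?M)"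
        unfolding Vol_def
        by (intro arg_cong[where f = det]) (auto simp: vec_eq_iff row_def split: option.split)
      also have "\<dots> = det ?M" using row_op(2) by (intro det_row_operation) simp
      also have "\<dots> = det A * Vol X w" using row_op(1) unfolding Y_def Vol_def by blast
      also have "det A = det ?B"
        using det_row_operation[OF row_op(2), of A c] unfolding scalar_mult_eq_scaleR by (rule sym)
      finally show "Vol (\<lambda>k. \<Sum>j\<in>UNIV. ?B $ k $ j *\<^sub>R X j) w = det ?B * Vol X w" .
    qed
  qed
  then show ?thesis by blast
qed

text \<open>\<open>pos_definite\<close> does not ask for symmetry, so the argument avoids
  eigenvalues: the segment from the identity to \<open>A\<close> consists of positive definite,
  hence nonsingular matrices, and the determinant keeps the sign it has at the identity.\<close>

lemma pos_definite_det_pos: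
  fixes A :: "real ^ 'n::finite ^ 'n"
  assumes "pos_definite A"
  shows "det A > 0"
proof -
  define M where "M t = (1 - t) *\<^sub>R mat 1 + t *\<^sub>R A" for t :: real
  have Mv: "M t *v v = (1 - t) *\<^sub>R v + t *\<^sub>R (A *v v)" for t v
    unfolding M_def
    by (simp add: matrix_vector_mult_add_rdistrib scaleR_matrix_vector_assoc[symmetric])
  have nz: "det (M t) \<noteq> 0" if "0 \<le> t" "t \<le> 1" for t
  proof
    assume "det (M t) = 0"
    then obtain v where v: "v \<noteq> 0" "M t *v v = 0"
      using invertible_det_nz[of "M t"] matrix_left_invertible_ker[of "M t"] invertible_left_inverse by blast
    have "0 = v \<bullet> (M t *v v)" using v by simp
    also have "\<dots> = (1 - t) * (v \<bullet> v) + t * (v \<bullet> (A *v v))"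
      unfolding Mv by (simp add: inner_add_right)
    also have "\<dots> > 0"
    proof (cases "t = 0")
      case False
      then have "t * (v \<bullet> (A *v v)) > 0" using assms v that unfolding pos_definite_def by simp
      then show ?thesis using that by (simp add: add_nonneg_pos)
    qed (use v in simp)
    finally show False by simp
  qed
  have "continuous_on {0..1} (\<lambda>t. det (M t))"
    unfolding det_def M_def by (intro continuous_intros)
  then have "0 < det (M 1)"
    using IVT2'[of "\<lambda>t. det (M t)" 1 0 0] nz by (force simp: M_def not_le)
  then show ?thesis by (simp add: M_def)
qed

text \<open>The linear form nu of the overview, represented by a vector through the Euclidean inner
  product, so that it can be differentiated by the product rule.\<close>

definition conormal :: "(real ^ 'n::finite \<Rightarrow> real ^ 'n option) \<Rightarrow> real ^ 'n \<Rightarrow> real ^ 'n option" where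
  "conormal F u = (\<chi> a. Vol (\<lambda>k. pd k F u) (axis a 1))"

lemma Vol_eq_conormal: "Vol (\<lambda>k. pd k F u) w = conormal F u \<bullet> w"
proof -
  have "Vol (\<lambda>k. pd k F u) w = Vol (\<lambda>k. pd k F u) (\<Sum>a\<in>UNIV. w $ a *\<^sub>R axis a 1)"
    using vec_eq_sum_axis[of w] by simp
  also have "\<dots> = conormal F u \<bullet> w"
    by (simp add: linear_sum[OF linear_Vol] linear_cmul[OF linear_Vol] conormal_def inner_vec_def mult.commute)
  finally show ?thesis .
qed

lemma conormal_tangent [simp]: "conormal F u \<bullet> pd k F u = 0"
  unfolding Vol_eq_conormal[symmetric] by (rule Vol_tangent)

definition hess :: "(real ^ 'n::finite \<Rightarrow> real ^ 'n option) \<Rightarrow> real ^ 'n \<Rightarrow> real ^ 'n ^ 'n" where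
  "hess F u = (\<chi> i j. conormal F u \<bullet> pd j (pd i F) u)"

lemma smooth_on_conormal:
  assumes S: "open S" and F: "smooth_on S F"
  shows "smooth_on S (conormal F)"
proof -
  have "smooth_on S (\<lambda>u. Vol (\<lambda>k. pd k F u) w)" for w
    unfolding Vol_def
  proof (rule smooth_on_det[OF S])
    fix a b :: "'a option"
    show "smooth_on S (\<lambda>u. (\<chi> a. case a of Some i \<Rightarrow> pd i F u | None \<Rightarrow> w) $ a $ b)"
    proof (cases a)
      case (Some i)
      have "smooth_on S (\<lambda>u. pd i F u $ b)"
        by (rule smooth_on_bounded_linear_comp[OF S bounded_linear_vec_nth smooth_on_pd[OF F]])
      then show ?thesis using Some by simp
    qed (simp add: smooth_on_const)
  qed
  then have sm: "smooth_on S (\<lambda>u. \<Sum>a\<in>UNIV. Vol (\<lambda>k. pd k F u) (axis a 1) *\<^sub>R axis a 1)"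
    by (intro smooth_on_sum[OF S] smooth_on_scaleR[OF S] smooth_on_const)
  have eq: "(\<Sum>a\<in>UNIV. Vol (\<lambda>k. pd k F u) (axis a 1) *\<^sub>R axis a 1) = conormal F u" for u
    using vec_eq_sum_axis[of "conormal F u"] by (simp add: conormal_def)
  show ?thesis by (rule smooth_on_cong[OF S eq sm])
qed

text \<open>Derivative of the identity nu(x_j) = 0. Through it the nonsingularity of h becomes a
  statement about the derivatives of nu.\<close>

lemma pd_conormal_tangent:
  assumes S: "open S" "u \<in> S" and F: "smooth_on S F"
  shows "pd k (conormal F) u \<bullet> pd j F u = - hess F u $ j $ k"
proof -
  have "pd k (\<lambda>u. conormal F u \<bullet> pd j F u) u =
      conormal F u \<bullet> pd k (pd j F) u + pd k (conormal F) u \<bullet> pd j F u"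
    by (rule pd_inner[OF smooth_on_imp_differentiable[OF smooth_on_conormal[OF S(1) F] S(2)]
        smooth_on_imp_differentiable[OF smooth_on_pd[OF F] S(2)]])
  then show ?thesis by (simp add: hess_def)
qed

section \<open>The affine normal in coordinates\<close>

lemma det_scaleR:
  fixes A :: "real ^ 'n::finite ^ 'n"
  shows "det (c *\<^sub>R A) = c ^ CARD('n) * det A"
proof -
  have "c *\<^sub>R A = (\<chi> i. c *s A $ i)" by (simp add: vec_eq_iff)
  then show ?thesis using det_rows_mul[of "\<lambda>_. c" "\<lambda>i. A $ i"] by simp
qed

lemma matrix_inv_unique:
  fixes A B :: "real ^ 'n::finite ^ 'n"
  assumes "A ** B = mat 1"
  shows "matrix_inv A = B"
proof -
  have "invertible A" using assms invertible_right_inverse by blast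
  from matrix_inv(2)[OF this] have "matrix_inv A ** (A ** B) = B"
    by (simp add: matrix_mul_assoc)
  then show ?thesis using assms by simp
qed

lemma matrix_scaleR_mult:
  fixes A B :: "real ^ 'n::finite ^ 'n"
  shows "(a *\<^sub>R A) ** (b *\<^sub>R B) = (a * b) *\<^sub>R (A ** B)"
  by (simp add: vec_eq_iff matrix_matrix_mult_def sum_distrib_left mult_ac)

lemma matrix_inv_scaleR:
  fixes A :: "real ^ 'n::finite ^ 'n"
  assumes "invertible A" "c \<noteq> 0"
  shows "matrix_inv (c *\<^sub>R A) = inverse c *\<^sub>R matrix_inv A"
  by (rule matrix_inv_unique) (use assms in \<open>simp add: matrix_scaleR_mult matrix_inv\<close>)

definition metric :: "(real ^ 'n::finite \<Rightarrow> real ^ 'n option) \<Rightarrow> real ^ 'n \<Rightarrow> real ^ 'n ^ 'n" where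
  "metric F u = (\<bar>det (hess F u)\<bar> powr (- 1 / (real CARD('n) + 2))) *\<^sub>R hess F u"

text \<open>The formula of \<open>laplacian\<close> for the Blaschke metric, transcribed to
  coordinate space; \<open>laplacian_Blaschke_eq\<close> links the two.\<close>

definition anormal :: "(real ^ 'n::finite \<Rightarrow> real ^ 'n option) \<Rightarrow> real ^ 'n \<Rightarrow> real ^ 'n option" where
  "anormal F u = (1 / real CARD('n)) *\<^sub>R ((1 / sqrt \<bar>det (metric F u)\<bar>) *\<^sub>R
     (\<Sum>i\<in>UNIV. pd i (\<lambda>q. sqrt \<bar>det (metric F q)\<bar> *\<^sub>R
        (\<Sum>j\<in>UNIV. (matrix_inv (metric F q) $ i $ j) *\<^sub>R pd j F q)) u))"

definition rho :: "(real ^ 'n::finite \<Rightarrow> real ^ 'n option) \<Rightarrow> real ^ 'n \<Rightarrow> real" where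
  "rho F u = det (hess F u) powr (1 / (real CARD('n) + 2))"

section \<open>The affine normal of a positively oriented coordinate patch\<close>

locale convex_patch =
  fixes U :: "(real ^ 'n::finite) set" and F :: "real ^ 'n \<Rightarrow> real ^ 'n option"
  assumes open_U: "open U" and smooth_F: "smooth_on U F"
    and posdef: "\<And>u. u \<in> U \<Longrightarrow> pos_definite (hess F u)"
begin

abbreviation "N \<equiv> conormal F"
abbreviation "h \<equiv> hess F"
abbreviation "r \<equiv> rho F"

lemma det_pos: "u \<in> U \<Longrightarrow> det (h u) > 0"
  by (rule pos_definite_det_pos[OF posdef])

lemma inv_h: "u \<in> U \<Longrightarrow> invertible (h u)"
  using det_pos by (force simp: invertible_det_nz)

lemma rho_pos: "u \<in> U \<Longrightarrow> r u > 0"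
  using det_pos by (force simp: rho_def)

lemma rho_power: "u \<in> U \<Longrightarrow> r u ^ (CARD('n) + 2) = det (h u)"
  using det_pos[of u] rho_pos[of u]
  by (simp add: powr_realpow[symmetric] rho_def powr_powr add.commute del: power_Suc)

text \<open>With H = det h, scaling n rows by H^(-1/(n+2)) leaves H^(1 - n/(n+2)) = H^(2/(n+2)),
  which is the square of rho.\<close>

lemma sqrt_det_metric:
  assumes "u \<in> U"
  shows "sqrt \<bar>det (metric F u)\<bar> = r u"
proof -
  let ?n = "real CARD('n)" and ?H = "det (h u)"
  have "det (metric F u) = (?H powr (- 1 / (?n + 2))) ^ CARD('n) * ?H"
    using det_pos[OF assms] by (simp add: metric_def det_scaleR)
  also have "(?H powr (- 1 / (?n + 2))) ^ CARD('n) = ?H powr (- ?n / (?n + 2))"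
    using det_pos[OF assms] by (simp add: powr_realpow[symmetric] powr_powr)
  also have "\<dots> * ?H = ?H powr (- ?n / (?n + 2)) * ?H powr 1"
    using det_pos[OF assms] by simp
  also have "\<dots> = ?H powr (- ?n / (?n + 2) + 1)"
    by (rule powr_add[symmetric])
  also have "- ?n / (?n + 2) + 1 = 1 / (?n + 2) + 1 / (?n + 2)"
    by (simp add: field_simps)
  also have "?H powr \<dots> = r u * r u"
    unfolding rho_def by (rule powr_add)
  finally show ?thesis using rho_pos[OF assms] by simp
qed

lemma inv_metric:
  assumes "u \<in> U"
  shows "matrix_inv (metric F u) = r u *\<^sub>R matrix_inv (h u)"
  using det_pos[OF assms] matrix_inv_scaleR[OF inv_h[OF assms]]
  by (simp add: metric_def rho_def powr_minus[symmetric])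

text \<open>\<open>P i j\<close> is \<open>\<surd>(det G) G^ij\<close> for the Blaschke metric \<open>G\<close>.\<close>

definition P where "P i j u = (r u)\<^sup>2 * matrix_inv (h u) $ i $ j"

lemma smooth_N: "smooth_on U N"
  by (rule smooth_on_conormal[OF open_U smooth_F])

lemma smooth_h: "smooth_on U (\<lambda>u. h u $ i $ j)"
  unfolding hess_def by (simp, intro smooth_on_inner[OF open_U] smooth_N smooth_on_pd smooth_F)

lemma smooth_r: "smooth_on U r"
  unfolding rho_def[abs_def]
  by (intro smooth_on_powr[OF open_U] det_pos smooth_on_det[OF open_U] smooth_h)

lemma smooth_P: "smooth_on U (P i j)"
proof -
  have "smooth_on U (\<lambda>u. matrix_inv (h u) $ i $ j)"
    using det_pos by (intro smooth_on_matrix_inv[OF open_U smooth_h]) force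
  then show ?thesis
    unfolding P_def[abs_def] power2_eq_square by (intro smooth_on_mult[OF open_U] smooth_r)
qed

lemmas diff = smooth_on_imp_differentiable

lemma smooth_PF: "smooth_on U (\<lambda>q. P i j q *\<^sub>R pd j F q)"
  by (intro smooth_on_scaleR[OF open_U] smooth_P smooth_on_pd smooth_F)

text \<open>Product rule in the divergence form of the Laplacian. Only the summands with second
  derivatives have a transversal part; those with derivatives of \<open>P\<close> are
  tangential.\<close>

lemma anormal_eq:
  assumes u: "u \<in> U"
  shows "anormal F u = (1 / (real CARD('n) * r u)) *\<^sub>R
    (\<Sum>i\<in>UNIV. \<Sum>j\<in>UNIV. P i j u *\<^sub>R pd i (pd j F) u + pd i (P i j) u *\<^sub>R pd j F u)"
proof -
  have 1: "pd i (\<lambda>q. sqrt \<bar>det (metric F q)\<bar> *\<^sub>R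
        (\<Sum>j\<in>UNIV. (matrix_inv (metric F q) $ i $ j) *\<^sub>R pd j F q)) u =
      pd i (\<lambda>q. \<Sum>j\<in>UNIV. P i j q *\<^sub>R pd j F q) u" for i
    by (rule pd_cong[OF open_U u])
      (simp add: sqrt_det_metric inv_metric P_def scaleR_sum_right power2_eq_square mult.assoc)
  have 2: "pd i (\<lambda>q. \<Sum>j\<in>UNIV. P i j q *\<^sub>R pd j F q) u =
     (\<Sum>j\<in>UNIV. pd i (\<lambda>q. P i j q *\<^sub>R pd j F q) u)" for i
    by (rule pd_sum[OF diff[OF smooth_PF u]])
  have 3: "pd i (\<lambda>q. P i j q *\<^sub>R pd j F q) u =
     P i j u *\<^sub>R pd i (pd j F) u + pd i (P i j) u *\<^sub>R pd j F u" for i j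
    by (rule pd_scaleR[OF diff[OF smooth_P u] diff[OF smooth_on_pd[OF smooth_F] u]])
  show ?thesis
    unfolding anormal_def 1 2 3 sqrt_det_metric[OF u] by simp
qed

lemma smooth_anormal: "smooth_on U (anormal F)"
proof (rule smooth_on_cong[OF open_U anormal_eq[symmetric]])
  have "smooth_on U (\<lambda>u. inverse (real CARD('n) * r u))"
    using rho_pos by (intro smooth_on_inverse[OF open_U] smooth_on_mult[OF open_U] smooth_on_const smooth_r) force
  then show "smooth_on U (\<lambda>u. (1 / (real CARD('n) * r u)) *\<^sub>R
    (\<Sum>i\<in>UNIV. \<Sum>j\<in>UNIV. P i j u *\<^sub>R pd i (pd j F) u + pd i (P i j) u *\<^sub>R pd j F u))"
    unfolding inverse_eq_divide
    by (intro smooth_on_scaleR[OF open_U] smooth_on_sum[OF open_U] smooth_on_add[OF open_U]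
        smooth_P smooth_on_pd smooth_F)
qed

lemma sum_P_h:
  assumes u: "u \<in> U"
  shows "(\<Sum>j\<in>UNIV. P i j u * h u $ j $ k) = (if i = k then (r u)\<^sup>2 else 0)"
proof -
  have "(\<Sum>j\<in>UNIV. P i j u * h u $ j $ k) = (r u)\<^sup>2 * (matrix_inv (h u) ** h u) $ i $ k"
    by (simp add: P_def matrix_matrix_mult_def sum_distrib_left mult.assoc)
  then show ?thesis by (simp add: matrix_inv[OF inv_h[OF u]] mat_def)
qed

lemma sum_h_P:
  assumes u: "u \<in> U"
  shows "(\<Sum>j\<in>UNIV. h u $ i $ j * P j k u) = (if i = k then (r u)\<^sup>2 else 0)"
proof -
  have "(\<Sum>j\<in>UNIV. h u $ i $ j * P j k u) = (r u)\<^sup>2 * (h u ** matrix_inv (h u)) $ i $ k"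
    by (simp add: P_def matrix_matrix_mult_def sum_distrib_left mult_ac)
  then show ?thesis by (simp add: matrix_inv[OF inv_h[OF u]] mat_def)
qed

lemma N_pd_pd: "N u \<bullet> pd i (pd j F) u = h u $ j $ i"
  by (simp add: hess_def)

lemma N_anormal:
  assumes u: "u \<in> U"
  shows "N u \<bullet> anormal F u = r u"
proof -
  have "N u \<bullet> anormal F u = (1 / (real CARD('n) * r u)) * (\<Sum>i\<in>UNIV. \<Sum>j\<in>UNIV. P i j u * h u $ j $ i)"
    unfolding anormal_eq[OF u] by (simp add: inner_sum_right inner_add_right N_pd_pd)
  also have "(\<Sum>i\<in>UNIV. \<Sum>j\<in>UNIV. P i j u * h u $ j $ i) = real CARD('n) * (r u)\<^sup>2"
    by (simp add: sum_P_h[OF u])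
  finally show ?thesis using rho_pos[OF u] by (simp add: power2_eq_square)
qed

lemma transversal_exists:
  assumes u: "u \<in> U"
  shows "\<exists>\<xi>. Vol (\<lambda>k. pd k F u) \<xi> = 1"
  using N_anormal[OF u] rho_pos[OF u]
  by (intro exI[of _ "(1 / r u) *\<^sub>R anormal F u"]) (simp add: Vol_eq_conormal)

text \<open>In terms of the connection \<open>\<Gamma>\<close> induced by a constant transversal vector, both contractions
  below equal \<open>\<Sum>\<^sub>s \<Gamma>\<^sup>s\<^sub>s\<^sub>k\<close>, with opposite signs.\<close>

lemma apolarity:
  assumes u: "u \<in> U"
  shows "(\<Sum>i\<in>UNIV. \<Sum>j\<in>UNIV. P i j u * (pd i N u \<bullet> pd k (pd j F) u)) = 0"
proof -
  obtain \<xi> where \<xi>: "Vol (\<lambda>k. pd k F u) \<xi> = 1" using transversal_exists[OF u] by blast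
  have ex: "\<exists>\<Gamma>. pd i (pd j F) u = (\<Sum>m\<in>UNIV. \<Gamma> m *\<^sub>R pd m F u) + h u $ j $ i *\<^sub>R \<xi>" for i j
    using Vol_decomp_exists[OF \<xi>, of "pd i (pd j F) u"] unfolding Vol_eq_conormal N_pd_pd .
  define \<Gamma> where "\<Gamma> i j =
    (SOME g. pd i (pd j F) u = (\<Sum>m\<in>UNIV. g m *\<^sub>R pd m F u) + h u $ j $ i *\<^sub>R \<xi>)" for i j
  have \<Gamma>: "pd i (pd j F) u = (\<Sum>m\<in>UNIV. \<Gamma> i j m *\<^sub>R pd m F u) + h u $ j $ i *\<^sub>R \<xi>" for i j
    unfolding \<Gamma>_def by (rule someI_ex[OF ex])
  have N\<xi>: "pd i N u \<bullet> \<xi> = (\<Sum>s\<in>UNIV. \<Gamma> i s s)" for i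
  proof -
    let ?A = "\<lambda>u. \<chi> a. case a of Some i \<Rightarrow> pd i F u | None \<Rightarrow> \<xi>"
    \<comment> \<open>Connection matrix of the frame (x_1, ..., x_n, xi) in direction
      \<open>i\<close>. The field xi is constant, so its row vanishes and the trace consists of the
      tangential coefficients alone.\<close>
    let ?C = "\<chi> a b. case a of None \<Rightarrow> 0 | Some s \<Rightarrow> (case b of Some m \<Rightarrow> \<Gamma> i s m | None \<Rightarrow> h u $ s $ i)"
    have dF: "pd s F differentiable (at u)" for s
      by (rule diff[OF smooth_on_pd[OF smooth_F] u])
    have "pd i (\<lambda>u. det (?A u)) u = trace ?C * det (?A u)"
    proof (rule pd_det)
      fix a b
      show "(\<lambda>u. ?A u $ a $ b) differentiable (at u)"
      proof (cases a)
        case (Some s)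
        then show ?thesis
          using bounded_linear.has_derivative[OF bounded_linear_vec_nth[of b] frechet_derivativeI[OF dF[of s]]]
          by (auto intro: differentiableI)
      qed simp
      show "pd i (\<lambda>u. ?A u $ a $ b) u = (?C ** ?A u) $ a $ b"
      proof (cases a)
        case (Some s)
        have "pd i (\<lambda>u. pd s F u $ b) u = pd i (pd s F) u $ b"
          using pd_eqI[OF bounded_linear.has_derivative[OF bounded_linear_vec_nth[of b] frechet_derivativeI[OF dF[of s]]]]
          by (simp add: pd_def[of i "pd s F"])
        also have "\<dots> = (\<Sum>m\<in>UNIV. \<Gamma> i s m * pd m F u $ b) + h u $ s $ i * \<xi> $ b"
          unfolding \<Gamma> by simp
        finally show ?thesis using Some
          by (simp add: matrix_matrix_mult_def UNIV_option_conv sum.reindex)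
      qed (simp add: matrix_matrix_mult_def)
    qed
    moreover have "det (?A q) = N q \<bullet> \<xi>" for q
      unfolding Vol_eq_conormal[symmetric] Vol_def ..
    moreover have "N u \<bullet> \<xi> = 1" using \<xi> by (simp add: Vol_eq_conormal)
    moreover have "pd i (\<lambda>q. N q \<bullet> \<xi>) u = pd i N u \<bullet> \<xi>"
      using pd_inner[OF diff[OF smooth_N u] differentiable_const[of \<xi>]] by simp
    moreover have "trace ?C = (\<Sum>s\<in>UNIV. \<Gamma> i s s)"
      by (simp add: trace_def UNIV_option_conv sum.reindex)
    ultimately show ?thesis by simp
  qed
  have 1: "pd i N u \<bullet> pd k (pd j F) u =
      - (\<Sum>m\<in>UNIV. \<Gamma> k j m * h u $ m $ i) + h u $ j $ k * (\<Sum>s\<in>UNIV. \<Gamma> i s s)" for i j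
    unfolding \<Gamma> inner_add_right inner_sum_right inner_scaleR_right N\<xi>
    by (simp add: pd_conormal_tangent[OF open_U u smooth_F] sum_negf)
  have 2: "(\<Sum>i\<in>UNIV. \<Sum>j\<in>UNIV. P i j u * (\<Sum>m\<in>UNIV. \<Gamma> k j m * h u $ m $ i)) = (r u)\<^sup>2 * (\<Sum>s\<in>UNIV. \<Gamma> k s s)"
  proof -
    have "(\<Sum>i\<in>UNIV. \<Sum>j\<in>UNIV. P i j u * (\<Sum>m\<in>UNIV. \<Gamma> k j m * h u $ m $ i)) =
        (\<Sum>i\<in>UNIV. \<Sum>j\<in>UNIV. \<Sum>m\<in>UNIV. \<Gamma> k j m * (h u $ m $ i * P i j u))"
      by (simp add: sum_distrib_left mult_ac)
    also have "\<dots> = (\<Sum>j\<in>UNIV. \<Sum>i\<in>UNIV. \<Sum>m\<in>UNIV. \<Gamma> k j m * (h u $ m $ i * P i j u))"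
      by (rule sum.swap)
    also have "\<dots> = (\<Sum>j\<in>UNIV. \<Sum>m\<in>UNIV. \<Sum>i\<in>UNIV. \<Gamma> k j m * (h u $ m $ i * P i j u))"
      by (rule sum.cong[OF refl sum.swap])
    also have "\<dots> = (\<Sum>j\<in>UNIV. \<Sum>m\<in>UNIV. \<Gamma> k j m * (\<Sum>i\<in>UNIV. h u $ m $ i * P i j u))"
      by (simp only: sum_distrib_left)
    also have "\<dots> = (\<Sum>j\<in>UNIV. \<Gamma> k j j * (r u)\<^sup>2)"
      unfolding sum_h_P[OF u] by (simp add: if_distrib cong: if_cong)
    also have "\<dots> = (r u)\<^sup>2 * (\<Sum>s\<in>UNIV. \<Gamma> k s s)"
      unfolding sum_distrib_right[symmetric] by (rule mult.commute)
    finally show ?thesis .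
  qed
  have 3: "(\<Sum>i\<in>UNIV. \<Sum>j\<in>UNIV. P i j u * (h u $ j $ k * (\<Sum>s\<in>UNIV. \<Gamma> i s s))) = (r u)\<^sup>2 * (\<Sum>s\<in>UNIV. \<Gamma> k s s)"
  proof -
    have "(\<Sum>i\<in>UNIV. \<Sum>j\<in>UNIV. P i j u * (h u $ j $ k * (\<Sum>s\<in>UNIV. \<Gamma> i s s))) =
       (\<Sum>i\<in>UNIV. (\<Sum>j\<in>UNIV. P i j u * h u $ j $ k) * (\<Sum>s\<in>UNIV. \<Gamma> i s s))"
      by (simp only: sum_distrib_right mult.assoc)
    also have "\<dots> = (r u)\<^sup>2 * (\<Sum>s\<in>UNIV. \<Gamma> k s s)"
      unfolding sum_P_h[OF u] by (simp add: if_distrib[of "\<lambda>x. x * _"] cong: if_cong)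
    finally show ?thesis .
  qed
  show ?thesis
    unfolding 1 using 2 3
    by (simp only: distrib_left sum.distrib mult_minus_right sum_negf)
qed

text \<open>Equivalent, given nu(Y) = rho, to Y having tangential derivatives. Inserting the formula
  for Y gives n rho nu_k(Y) as a contraction of P with nu_k(x_ij) minus a divergence of P contracted
  with h. The third derivatives of x in the two terms cancel by symmetry, \<open>apolarity\<close>
  removes the terms left in the second, and (n + 2) rho rho_k - 2 rho rho_k remains.\<close>

lemma pd_conormal_anormal:
  assumes u: "u \<in> U"
  shows "pd k N u \<bullet> anormal F u = pd k r u"
proof -
  let ?n = "real CARD('n)"
  have dr: "r differentiable (at u)" and dh: "\<And>i j. (\<lambda>u. h u $ i $ j) differentiable (at u)"
    and dP: "\<And>i j. P i j differentiable (at u)"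
    by (rule diff[OF smooth_r u] diff[OF smooth_h u] diff[OF smooth_P u])+
  have dh': "pd i (\<lambda>u. h u $ j $ l) u = N u \<bullet> pd i (pd l (pd j F)) u + pd i N u \<bullet> pd l (pd j F) u" for i j l
    unfolding hess_def
    using pd_inner[OF diff[OF smooth_N u] diff[OF smooth_on_pd[OF smooth_on_pd[OF smooth_F]] u], of i l j]
    by simp
  \<comment> \<open>Logarithmic derivative of rho^(n+2) = det h, which is the origin of the factor n
    + 2.\<close>
  have A: "(\<Sum>i\<in>UNIV. \<Sum>j\<in>UNIV. P i j u * pd k (\<lambda>u. h u $ j $ i) u) = (?n + 2) * r u * pd k r u"
  proof -
    let ?D = "\<chi> i j. pd k (\<lambda>u. h u $ i $ j) u"
    have "pd k (\<lambda>u. det (h u)) u = trace (?D ** matrix_inv (h u)) * det (h u)"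
      by (rule pd_det[OF dh]) (simp add: matrix_mul_assoc[symmetric] matrix_inv[OF inv_h[OF u]])
    moreover have "pd k (\<lambda>u. det (h u)) u = pd k (\<lambda>u. r u ^ (CARD('n) + 2)) u"
      by (rule pd_cong[OF open_U u]) (simp only: rho_power)
    moreover have "pd k (\<lambda>u. r u ^ (CARD('n) + 2)) u = (?n + 2) * r u ^ (CARD('n) + 1) * pd k r u"
      using pd_eqI[OF has_derivative_power[OF frechet_derivativeI[OF dr], of "CARD('n) + 2"], of k]
      by (simp add: pd_def[of k r])
    ultimately have "trace (?D ** matrix_inv (h u)) * r u ^ (CARD('n) + 2) = (?n + 2) * r u ^ (CARD('n) + 1) * pd k r u"
      using rho_power[OF u] by simp
    then have "r u ^ (CARD('n) + 1) * (trace (?D ** matrix_inv (h u)) * r u) = r u ^ (CARD('n) + 1) * ((?n + 2) * pd k r u)"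
      by (simp add: mult_ac)
    then have t: "trace (?D ** matrix_inv (h u)) * r u = (?n + 2) * pd k r u"
      using rho_pos[OF u] by simp
    have "(\<Sum>i\<in>UNIV. \<Sum>j\<in>UNIV. P i j u * pd k (\<lambda>u. h u $ j $ i) u) = (r u)\<^sup>2 * trace (?D ** matrix_inv (h u))"
      unfolding trace_def matrix_matrix_mult_def
      by (subst sum.swap) (simp add: P_def sum_distrib_left mult_ac)
    also have "\<dots> = r u * (trace (?D ** matrix_inv (h u)) * r u)"
      by (simp add: power2_eq_square mult_ac)
    finally show ?thesis unfolding t by (simp add: mult_ac)
  qed
  \<comment> \<open>Differentiating P h = rho^2 I gives the divergence of \<open>P\<close> without a
    formula for the derivative of an inverse matrix.\<close>
  have B: "(\<Sum>j\<in>UNIV. pd i (P i j) u * h u $ j $ k) =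
      (if i = k then 2 * r u * pd k r u else 0) - (\<Sum>j\<in>UNIV. P i j u * pd i (\<lambda>u. h u $ j $ k) u)" for i
  proof -
    have "pd i (\<lambda>u. \<Sum>j\<in>UNIV. P i j u * h u $ j $ k) u =
       (\<Sum>j\<in>UNIV. P i j u * pd i (\<lambda>u. h u $ j $ k) u + pd i (P i j) u * h u $ j $ k)"
      by (subst pd_sum) (auto intro!: sum.cong pd_mult dP dh differentiable_mult)
    moreover have "pd i (\<lambda>u. \<Sum>j\<in>UNIV. P i j u * h u $ j $ k) u = pd i (\<lambda>u. if i = k then (r u)\<^sup>2 else 0) u"
      by (rule pd_cong[OF open_U u]) (rule sum_P_h)
    moreover have "pd i (\<lambda>u. if i = k then (r u)\<^sup>2 else 0) u = (if i = k then 2 * r u * pd k r u else 0)"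
      using pd_mult[OF dr dr, of k] by (simp add: power2_eq_square)
    ultimately show ?thesis by (simp add: sum.distrib)
  qed
  have sym: "pd k (pd i (pd j F)) u = pd i (pd k (pd j F)) u" for i j
    by (rule pd_commute[OF open_U u smooth_on_pd[OF smooth_F]])
  have "?n * r u * (pd k N u \<bullet> anormal F u) =
      (\<Sum>i\<in>UNIV. \<Sum>j\<in>UNIV. P i j u * (pd k N u \<bullet> pd i (pd j F) u) - pd i (P i j) u * h u $ j $ k)"
    unfolding anormal_eq[OF u] using rho_pos[OF u]
    by (simp add: inner_sum_right inner_add_right pd_conormal_tangent[OF open_U u smooth_F])
  also have "\<dots> = (\<Sum>i\<in>UNIV. \<Sum>j\<in>UNIV. P i j u * (pd k N u \<bullet> pd i (pd j F) u)) -
     (\<Sum>i\<in>UNIV. \<Sum>j\<in>UNIV. pd i (P i j) u * h u $ j $ k)"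
    by (simp only: sum_subtractf)
  also have "(\<Sum>i\<in>UNIV. \<Sum>j\<in>UNIV. P i j u * (pd k N u \<bullet> pd i (pd j F) u)) =
      (\<Sum>i\<in>UNIV. \<Sum>j\<in>UNIV. P i j u * pd k (\<lambda>u. h u $ j $ i) u) -
      (\<Sum>i\<in>UNIV. \<Sum>j\<in>UNIV. P i j u * (N u \<bullet> pd k (pd i (pd j F)) u))"
    unfolding dh' by (simp add: sum_subtractf[symmetric] right_diff_distrib[symmetric])
  also have "(\<Sum>i\<in>UNIV. \<Sum>j\<in>UNIV. pd i (P i j) u * h u $ j $ k) =
      2 * r u * pd k r u - (\<Sum>i\<in>UNIV. \<Sum>j\<in>UNIV. P i j u * pd i (\<lambda>u. h u $ j $ k) u)"
    unfolding B by (simp add: sum_subtractf)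
  also have "(\<Sum>i\<in>UNIV. \<Sum>j\<in>UNIV. P i j u * pd i (\<lambda>u. h u $ j $ k) u) =
      (\<Sum>i\<in>UNIV. \<Sum>j\<in>UNIV. P i j u * (N u \<bullet> pd k (pd i (pd j F)) u))"
    unfolding dh' sym using apolarity[OF u, of k] by (simp add: distrib_left sum.distrib)
  finally have "?n * r u * (pd k N u \<bullet> anormal F u) = ?n * r u * pd k r u"
    unfolding A by (simp add: algebra_simps)
  then show ?thesis using rho_pos[OF u] by simp
qed

text \<open>The derivative of nu(Y) = rho is nu_k(Y) + nu(Y_k) = rho_k, and the first summand alone
  already equals rho_k.\<close>

lemma N_pd_anormal:
  assumes u: "u \<in> U"
  shows "N u \<bullet> pd k (anormal F) u = 0"
proof -
  have "pd k (\<lambda>u. N u \<bullet> anormal F u) u = pd k r u"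
    by (rule pd_cong[OF open_U u]) (rule N_anormal)
  then show ?thesis
    using pd_inner[OF diff[OF smooth_N u] diff[OF smooth_anormal u]] pd_conormal_anormal[OF u] by simp
qed

lemma tangent_decomp:
  assumes u: "u \<in> U" and "N u \<bullet> w = 0"
  shows "\<exists>c. w = (\<Sum>k\<in>UNIV. c k *\<^sub>R pd k F u)"
proof -
  obtain \<xi> where \<xi>: "Vol (\<lambda>k. pd k F u) \<xi> = 1" using transversal_exists[OF u] by blast
  show ?thesis using Vol_decomp_exists[OF \<xi>, of w] assms(2) by (simp add: Vol_eq_conormal)
qed

text \<open>Differentiating nu(Y - Z) = 0 and using tangency gives nu_k(Y - Z) = 0. But Y - Z is
  itself tangential, and on tangent vectors the forms nu_k are the rows of -h up to transposition,
  so the invertibility of h forces Y - Z = 0.\<close>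

lemma transversal_unique:
  assumes u: "u \<in> U" and d: "Y differentiable (at u)" "Z differentiable (at u)"
    and eq: "\<And>q. q \<in> U \<Longrightarrow> N q \<bullet> Y q = N q \<bullet> Z q"
    and 0: "\<And>k. N u \<bullet> pd k Y u = 0" "\<And>k. N u \<bullet> pd k Z u = 0"
  shows "Y u = Z u"
proof -
  have 1: "pd k N u \<bullet> (Y u - Z u) = 0" for k
  proof -
    have "pd k (\<lambda>q. N q \<bullet> Y q) u = pd k (\<lambda>q. N q \<bullet> Z q) u"
      by (rule pd_cong[OF open_U u eq])
    then show ?thesis
      using pd_inner[OF diff[OF smooth_N u] d(1), of k] pd_inner[OF diff[OF smooth_N u] d(2), of k] 0
      by (simp add: inner_diff_right)
  qed
  obtain c where c: "Y u - Z u = (\<Sum>k\<in>UNIV. c k *\<^sub>R pd k F u)"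
    using tangent_decomp[OF u, of "Y u - Z u"] eq[OF u] by (auto simp: inner_diff_right)
  have "(\<Sum>m\<in>UNIV. c m * h u $ m $ k) = 0" for k
    using 1[of k] unfolding c
    by (simp add: inner_sum_right pd_conormal_tangent[OF open_U u smooth_F] sum_negf)
  then have "(\<chi> m. c m) v* h u = 0"
    by (simp add: vec_eq_iff vector_matrix_mult_def mult.commute)
  then have "((\<chi> m. c m) v* h u) v* matrix_inv (h u) = 0" by simp
  then have "(\<chi> m. c m) = 0"
    by (simp add: vector_matrix_mul_assoc matrix_inv[OF inv_h[OF u]])
  then have "c k = 0" for k by (simp add: vec_eq_iff)
  then show ?thesis using c by simp
qed

end

section \<open>Coordinate changes and parallel patches\<close>

text \<open>Transposed to the usual Jacobian matrix: the row is the index of differentiation, so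
  frames change by multiplication from the left. \<open>shape_operator\<close> follows the same
  convention.\<close>

definition jac :: "(real ^ 'n::finite \<Rightarrow> real ^ 'n) \<Rightarrow> real ^ 'n \<Rightarrow> real ^ 'n ^ 'n" where
  "jac \<phi> v = (\<chi> i j. pd i \<phi> v $ j)"

lemma pd_comp:
  assumes "open V" "v \<in> V" and eq: "\<And>y. y \<in> V \<Longrightarrow> G y = F (\<phi> y)"
    and d: "\<phi> differentiable (at v)" "F differentiable (at (\<phi> v))"
  shows "pd i G v = (\<Sum>j\<in>UNIV. jac \<phi> v $ i $ j *\<^sub>R pd j F (\<phi> v))"
proof -
  have "pd i G v = pd i (\<lambda>y. F (\<phi> y)) v" by (rule pd_cong[OF assms(1,2) eq])
  then show ?thesis by (simp add: pd_compose[OF d] jac_def)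
qed

lemma conormal_eqI:
  assumes "\<And>w. Vol (\<lambda>k. pd k G v) w = c * (n \<bullet> w)"
  shows "conormal G v = c *\<^sub>R n"
  using assms by (simp add: conormal_def vec_eq_iff inner_axis)

lemma conormal_comp:
  assumes "open V" "v \<in> V" and eq: "\<And>y. y \<in> V \<Longrightarrow> G y = F (\<phi> y)"
    and d: "\<phi> differentiable (at v)" "F differentiable (at (\<phi> v))"
  shows "conormal G v = det (jac \<phi> v) *\<^sub>R conormal F (\<phi> v)"
proof (rule conormal_eqI)
  fix w
  have "Vol (\<lambda>k. pd k G v) w = Vol (\<lambda>k. \<Sum>j\<in>UNIV. jac \<phi> v $ k $ j *\<^sub>R pd j F (\<phi> v)) w"
    by (simp only: pd_comp[OF assms])
  then show "Vol (\<lambda>k. pd k G v) w = det (jac \<phi> v) * (conormal F (\<phi> v) \<bullet> w)"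
    by (simp only: Vol_matrix_rows Vol_eq_conormal)
qed

text \<open>Second derivatives of \<open>\<phi>\<close> enter only through tangential terms, which
  the conormal annihilates. The congruence comes from the two derivatives, the determinant from the
  conormal.\<close>

lemma hess_comp:
  assumes V: "open V" "v \<in> V" and eq: "\<And>y. y \<in> V \<Longrightarrow> G y = F (\<phi> y)"
    and sub: "\<And>y. y \<in> V \<Longrightarrow> \<phi> y \<in> U" and s: "smooth_on V \<phi>" "smooth_on U F"
  shows "hess G v = det (jac \<phi> v) *\<^sub>R (jac \<phi> v ** hess F (\<phi> v) ** transpose (jac \<phi> v))"
proof -
  note d = smooth_on_imp_differentiable
  have d\<phi>: "\<phi> differentiable (at y)" "F differentiable (at (\<phi> y))" if "y \<in> V" for y
    using d[OF s(1) that] d[OF s(2) sub[OF that]] by auto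
  have dJ: "(\<lambda>y. jac \<phi> y $ i $ k) differentiable (at v)" for i k
    using d[OF smooth_on_bounded_linear_comp[OF V(1) bounded_linear_vec_nth smooth_on_pd[OF s(1)]] V(2)]
    by (simp add: jac_def)
  have dF: "(\<lambda>y. pd k F (\<phi> y)) differentiable (at v)" for k
    using differentiable_chain_at[OF d\<phi>(1)[OF V(2)] d[OF smooth_on_pd[OF s(2)] sub[OF V(2)]], of k]
    by (simp add: o_def)
  have 1: "pd j (pd i G) v = (\<Sum>k\<in>UNIV. jac \<phi> v $ i $ k *\<^sub>R (\<Sum>l\<in>UNIV. jac \<phi> v $ j $ l *\<^sub>R pd l (pd k F) (\<phi> v))
      + pd j (\<lambda>y. jac \<phi> y $ i $ k) v *\<^sub>R pd k F (\<phi> v))" for i j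
  proof -
    have "pd j (pd i G) v = pd j (\<lambda>y. \<Sum>k\<in>UNIV. jac \<phi> y $ i $ k *\<^sub>R pd k F (\<phi> y)) v"
      by (rule pd_cong[OF V]) (rule pd_comp[OF V(1) _ eq d\<phi>])
    also have "\<dots> = (\<Sum>k\<in>UNIV. pd j (\<lambda>y. jac \<phi> y $ i $ k *\<^sub>R pd k F (\<phi> y)) v)"
      by (rule pd_sum) (rule differentiable_scaleR[OF dJ dF])
    also have "\<dots> = (\<Sum>k\<in>UNIV. jac \<phi> v $ i $ k *\<^sub>R pd j (\<lambda>y. pd k F (\<phi> y)) v
        + pd j (\<lambda>y. jac \<phi> y $ i $ k) v *\<^sub>R pd k F (\<phi> v))"
      by (intro sum.cong refl pd_scaleR[OF dJ dF])
    finally show ?thesis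
      unfolding pd_comp[OF V refl d\<phi>(1)[OF V(2)] d[OF smooth_on_pd[OF s(2)] sub[OF V(2)]]] .
  qed
  have "hess G v $ i $ j = det (jac \<phi> v) * (\<Sum>k\<in>UNIV. jac \<phi> v $ i $ k * (\<Sum>l\<in>UNIV. jac \<phi> v $ j $ l * hess F (\<phi> v) $ k $ l))" for i j
    by (simp add: hess_def[of G] conormal_comp[OF V eq d\<phi>[OF V(2)]] 1 inner_sum_right inner_add_right
        sum.distrib) (simp add: hess_def sum_distrib_left mult_ac)
  moreover have "(jac \<phi> v ** hess F (\<phi> v) ** transpose (jac \<phi> v)) $ i $ j =
      (\<Sum>k\<in>UNIV. jac \<phi> v $ i $ k * (\<Sum>l\<in>UNIV. jac \<phi> v $ j $ l * hess F (\<phi> v) $ k $ l))" for i j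
    unfolding matrix_mul_assoc[symmetric]
    by (simp add: matrix_matrix_mult_def transpose_def mult.commute)
  ultimately show ?thesis by (simp add: vec_eq_iff)
qed

lemma inner_matrix_congruence:
  fixes J A :: "real ^ 'n::finite ^ 'n"
  shows "v \<bullet> ((J ** A ** transpose J) *v v) = (transpose J *v v) \<bullet> (A *v (transpose J *v v))"
  by (simp add: matrix_vector_mul_assoc[symmetric] dot_lmul_matrix)

text \<open>Both sides have tangential derivatives and the same pairing with the conormal of
  \<open>G\<close>, so \<open>transversal_unique\<close> identifies them. This takes the place of a
  transformation law for the Laplacian.\<close>

lemma anormal_comp:
  assumes F: "convex_patch U F" and G: "convex_patch V G"
    and eq: "\<And>y. y \<in> V \<Longrightarrow> G y = F (\<phi> y)"
    and sub: "\<And>y. y \<in> V \<Longrightarrow> \<phi> y \<in> U" and s: "smooth_on V \<phi>" and v: "v \<in> V"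
  shows "anormal G v = anormal F (\<phi> v)"
proof -
  interpret F: convex_patch U F by (rule F)
  interpret G: convex_patch V G by (rule G)
  note d = smooth_on_imp_differentiable
  have d\<phi>: "\<phi> differentiable (at y)" "F differentiable (at (\<phi> y))" "anormal F differentiable (at (\<phi> y))"
    if "y \<in> V" for y
    using d[OF s that] d[OF F.smooth_F sub[OF that]] d[OF F.smooth_anormal sub[OF that]] by auto
  have con: "conormal G y = det (jac \<phi> y) *\<^sub>R conormal F (\<phi> y)" if "y \<in> V" for y
    by (rule conormal_comp[OF G.open_U that eq d\<phi>(1,2)[OF that]])
  have hess: "hess G y = det (jac \<phi> y) *\<^sub>R (jac \<phi> y ** hess F (\<phi> y) ** transpose (jac \<phi> y))" if "y \<in> V" for y
    by (rule hess_comp[OF G.open_U that eq sub s F.smooth_F])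
  \<comment> \<open>Orientation is preserved because both forms are positive definite: evaluating
    the one of \<open>G\<close> on a single vector gives the determinant times a nonnegative
    number.\<close>
  have pos: "det (jac \<phi> y) > 0" if "y \<in> V" for y
  proof -
    define e :: "real ^ 'a" where "e = axis undefined 1"
    let ?w = "transpose (jac \<phi> y) *v e"
    have "e \<noteq> 0" by (simp add: e_def)
    then have "0 < e \<bullet> (hess G y *v e)" using G.posdef[OF that] by (simp add: pos_definite_def)
    also have "\<dots> = det (jac \<phi> y) * (?w \<bullet> (hess F (\<phi> y) *v ?w))"
      unfolding hess[OF that] inner_matrix_congruence[symmetric]
      by (simp add: scaleR_matrix_vector_assoc[symmetric])
    finally have "0 < det (jac \<phi> y) * (?w \<bullet> (hess F (\<phi> y) *v ?w))" .
    moreover have "?w \<bullet> (hess F (\<phi> y) *v ?w) \<ge> 0"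
      using F.posdef[OF sub[OF that]] by (cases "?w = 0") (auto simp: pos_definite_def less_imp_le)
    ultimately show ?thesis by (simp add: zero_less_mult_iff)
  qed
  \<comment> \<open>The scalar factor contributes n powers of the Jacobian determinant and the
    congruence two more; the root of order n + 2 leaves exactly one.\<close>
  have rho: "rho G y = det (jac \<phi> y) * rho F (\<phi> y)" if "y \<in> V" for y
  proof -
    have "rho G y ^ (CARD('a) + 2) = (det (jac \<phi> y) * rho F (\<phi> y)) ^ (CARD('a) + 2)"
      unfolding G.rho_power[OF that] power_mult_distrib F.rho_power[OF sub[OF that]] hess[OF that] det_scaleR
      by (simp add: det_mul power_add power2_eq_square)
    moreover have "rho G y > 0" "det (jac \<phi> y) * rho F (\<phi> y) > 0"
      using G.rho_pos[OF that] F.rho_pos[OF sub[OF that]] pos[OF that] by auto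
    ultimately show ?thesis by (meson add_pos_pos less_imp_le pos2 power_eq_imp_eq_base zero_less_card_finite)
  qed
  have "anormal G v = (\<lambda>y. anormal F (\<phi> y)) v"
  proof (rule G.transversal_unique[OF v])
    show "anormal G differentiable (at v)" by (rule d[OF G.smooth_anormal v])
    show "(\<lambda>y. anormal F (\<phi> y)) differentiable (at v)"
      using differentiable_chain_at[OF d\<phi>(1,3)[OF v]] by (simp add: o_def)
    show "conormal G q \<bullet> anormal G q = conormal G q \<bullet> anormal F (\<phi> q)" if "q \<in> V" for q
      unfolding G.N_anormal[OF that] rho[OF that]
      by (simp add: con[OF that] F.N_anormal[OF sub[OF that]])
    show "conormal G v \<bullet> pd k (anormal G) v = 0" for k by (rule G.N_pd_anormal[OF v])
    show "conormal G v \<bullet> pd k (\<lambda>y. anormal F (\<phi> y)) v = 0" for k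
      unfolding con[OF v] pd_compose[OF d\<phi>(1,3)[OF v]]
      by (simp add: inner_sum_right F.N_pd_anormal[OF sub[OF v]])
  qed
  then show ?thesis .
qed

text \<open>\<open>B\<close> is given at the point \<open>u\<close> only, so the second derivatives
  of \<open>G\<close> cannot be found by differentiating \<open>B\<close>. Instead the tangency of
  \<open>pd i G\<close> to \<open>F\<close>, valid on all of \<open>U\<close>, is differentiated;
  this moves the second derivative onto the conormal of \<open>F\<close>, where
  \<open>pd_conormal_tangent\<close> applies.\<close>

lemma parallel_patch:
  assumes U: "open U" "u \<in> U" and F: "smooth_on U F"
    and Y: "\<And>q. q \<in> U \<Longrightarrow> Y differentiable (at q)"
    and Yt: "\<And>q i. q \<in> U \<Longrightarrow> conormal F q \<bullet> pd i Y q = 0"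
    and G: "smooth_on U G" "\<And>q. q \<in> U \<Longrightarrow> G q = F q + t *\<^sub>R Y q"
    and B: "\<And>i. pd i Y u = - (\<Sum>j\<in>UNIV. B $ i $ j *\<^sub>R pd j F u)"
  shows "pd i G u = (\<Sum>j\<in>UNIV. (mat 1 - t *\<^sub>R B) $ i $ j *\<^sub>R pd j F u)"
    and "conormal G u = det (mat 1 - t *\<^sub>R B) *\<^sub>R conormal F u"
    and "hess G u = det (mat 1 - t *\<^sub>R B) *\<^sub>R ((mat 1 - t *\<^sub>R B) ** hess F u)"
proof -
  let ?M = "mat 1 - t *\<^sub>R B"
  note d = smooth_on_imp_differentiable
  have pdG: "pd i G q = pd i F q + t *\<^sub>R pd i Y q" if "q \<in> U" for i q
  proof -
    have "pd i G q = pd i (\<lambda>q. F q + t *\<^sub>R Y q) q" by (rule pd_cong[OF U(1) that G(2)])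
    also have "\<dots> = pd i F q + pd i (\<lambda>q. t *\<^sub>R Y q) q"
      by (rule pd_add[OF d[OF F that] differentiable_scaleR[OF differentiable_const Y[OF that]]])
    also have "pd i (\<lambda>q. t *\<^sub>R Y q) q = t *\<^sub>R pd i Y q"
      using pd_scaleR[OF differentiable_const[of t] Y[OF that]] by simp
    finally show ?thesis .
  qed
  show 1: "pd i G u = (\<Sum>j\<in>UNIV. ?M $ i $ j *\<^sub>R pd j F u)" for i
  proof -
    have "pd i F u = (\<Sum>j\<in>UNIV. (mat 1 :: real^'a^'a) $ i $ j *\<^sub>R pd j F u)"
      by (simp add: mat_def if_distrib[of "\<lambda>x. x *\<^sub>R _"] cong: if_cong)
    then show ?thesis
      by (simp add: pdG[OF U(2)] B scaleR_diff_left sum_subtractf scaleR_sum_right)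
  qed
  show 2: "conormal G u = det ?M *\<^sub>R conormal F u"
    by (rule conormal_eqI) (simp only: 1 Vol_matrix_rows Vol_eq_conormal)
  have "conormal F u \<bullet> pd k (pd i G) u = (?M ** hess F u) $ i $ k" for i k
  proof -
    have "pd k (\<lambda>q. conormal F q \<bullet> pd i G q) u = pd k (\<lambda>q. 0 :: real) u"
      by (rule pd_cong[OF U]) (simp add: pdG inner_add_right Yt)
    then have "conormal F u \<bullet> pd k (pd i G) u = - (pd k (conormal F) u \<bullet> pd i G u)"
      using pd_inner[OF d[OF smooth_on_conormal[OF U(1) F] U(2)] d[OF smooth_on_pd[OF G(1)] U(2)], of k i]
      by simp
    then show ?thesis
      by (simp add: 1 inner_sum_right pd_conormal_tangent[OF U F] sum_negf matrix_matrix_mult_def)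
  qed
  then show "hess G u = det ?M *\<^sub>R (?M ** hess F u)"
    unfolding hess_def[of G] 2 by (simp add: vec_eq_iff)
qed

text \<open>The image of the derivative has dimension at most n, so it misses some vector
  \<open>w\<close>; injectivity makes \<open>w\<close> and the frame independent, and scaling
  \<open>w\<close> normalises the volume.\<close>

lemma inj_derivative_transversal:
  fixes F :: "real ^ 'n::finite \<Rightarrow> real ^ 'n option"
  assumes d: "F differentiable (at u)" and inj: "inj (frechet_derivative F (at u))"
  shows "\<exists>\<xi>. Vol (\<lambda>k. pd k F u) \<xi> = 1"
proof -
  let ?L = "frechet_derivative F (at u)"
  have lin: "linear ?L" by (rule linear_frechet_derivative[OF d])
  have "dim (range ?L) \<le> DIM(real ^ 'n)"
    using dim_image_le[OF lin, of UNIV] by simp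
  also have "\<dots> < DIM(real ^ 'n option)" by simp
  finally have "range ?L \<noteq> UNIV" by (metis dim_UNIV order_less_irrefl)
  then obtain w where w: "w \<notin> range ?L" by blast
  let ?A = "\<chi> a. case a of Some i \<Rightarrow> pd i F u | None \<Rightarrow> w"
  have "v = 0" if "v v* ?A = 0" for v
  proof -
    have "v v* ?A = (\<Sum>k\<in>UNIV. v $ Some k *\<^sub>R pd k F u) + v $ None *\<^sub>R w"
      by (simp add: vec_eq_iff vector_matrix_mult_def UNIV_option_conv sum.reindex mult.commute)
    also have "(\<Sum>k\<in>UNIV. v $ Some k *\<^sub>R pd k F u) = ?L (\<chi> k. v $ Some k)"
      by (simp add: frechet_derivative_eq_sum_pd[OF d])
    finally have *: "?L (\<chi> k. v $ Some k) + v $ None *\<^sub>R w = 0" using that by simp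
    have n: "v $ None = 0"
    proof (rule ccontr)
      assume nz: "v $ None \<noteq> 0"
      have "v $ None *\<^sub>R w = - ?L (\<chi> k. v $ Some k)"
        using * by (simp only: add.commute eq_neg_iff_add_eq_0)
      then have "(1 / v $ None) *\<^sub>R (v $ None *\<^sub>R w) = ?L ((1 / v $ None) *\<^sub>R - (\<chi> k. v $ Some k))"
        by (simp only: linear_cmul[OF lin] linear_neg[OF lin])
      moreover have "(1 / v $ None) *\<^sub>R (v $ None *\<^sub>R w) = w" using nz by simp
      ultimately have "w \<in> range ?L" by (simp only: rangeI)
      then show False using w by blast
    qed
    then have "?L (\<chi> k. v $ Some k) = ?L 0" using * unfolding linear_0[OF lin] by simp
    then have "(\<chi> k. v $ Some k) = 0" using inj by (simp add: inj_eq)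
    then have "v $ Some k = 0" for k by (simp add: vec_eq_iff)
    then show ?thesis using n by (simp add: vec_eq_iff) (metis option.exhaust)
  qed
  then have "det ?A \<noteq> 0"
    by (metis det_transpose invertible_det_nz invertible_left_inverse matrix_left_invertible_ker transpose_matrix_vector)
  then have nz: "Vol (\<lambda>k. pd k F u) w \<noteq> 0" by (simp add: Vol_def)
  show ?thesis
    by (rule exI[of _ "(1 / Vol (\<lambda>k. pd k F u) w) *\<^sub>R w"]) (simp add: linear_cmul[OF linear_Vol] nz)
qed

section \<open>Charts adapted to the orientation\<close>

lemma chart_coord_inv:
  assumes "is_chart c"
  shows "p \<in> dom_of c \<Longrightarrow> coord_inv c (coord c p) = p"
    and "u \<in> coord c ` dom_of c \<Longrightarrow> coord c (coord_inv c u) = u"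
    and "u \<in> coord c ` dom_of c \<Longrightarrow> coord_inv c u \<in> dom_of c"
  using assms unfolding is_chart_def homeomorphism_def by auto

lemma chart_open:
  assumes "is_chart c"
  shows "open (dom_of c)" "open (coord c ` dom_of c)" "continuous_on (dom_of c) (coord c)"
    "continuous_on (coord c ` dom_of c) (coord_inv c)"
  using assms unfolding is_chart_def homeomorphism_def by auto

lemma chart_open_image:
  assumes c: "is_chart c" and W: "open W" "W \<subseteq> dom_of c"
  shows "open (coord c ` W)"
proof -
  have "coord c ` W = coord c ` dom_of c \<inter> coord_inv c -` W"
  proof (intro equalityI subsetI)
    fix u assume "u \<in> coord c ` W"
    then show "u \<in> coord c ` dom_of c \<inter> coord_inv c -` W"
      using W(2) chart_coord_inv(1)[OF c] by auto
  next
    fix u assume "u \<in> coord c ` dom_of c \<inter> coord_inv c -` W"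
    then show "u \<in> coord c ` W"
      using chart_coord_inv(2)[OF c] by (intro image_eqI[of _ _ "coord_inv c u"]) auto
  qed
  then show ?thesis
    using continuous_open_preimage[OF chart_open(4,2)[OF c] W(1)]
    by simp
qed

lemma frame_frame_eq:
  assumes c: "is_chart c" and p: "p \<in> dom_of c"
  shows "frame c j (frame c i f) p = pd j (pd i (f \<circ> coord_inv c)) (coord c p)"
proof -
  have "pd j (frame c i f \<circ> coord_inv c) (coord c p) = pd j (pd i (f \<circ> coord_inv c)) (coord c p)"
    by (rule pd_cong[OF chart_open(2)[OF c] imageI[OF p]])
      (simp add: frame_def pd_def chart_coord_inv(2)[OF c])
  then show ?thesis by (simp add: frame_def pd_def)
qed

lemma frame_eq: "frame c i f p = pd i (f \<circ> coord_inv c) (coord c p)"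
  by (simp add: frame_def pd_def)

lemma immersion_smooth:
  "immersion \<A> x \<Longrightarrow> c \<in> \<A> \<Longrightarrow> smooth_on (coord c ` dom_of c) (x \<circ> coord_inv c)"
  by (simp add: immersion_def smooth_map_def)

text \<open>Injectivity of the derivative supplies a normalised transversal vector, without which
  the description in \<open>sff\<close> would be satisfied by nothing.\<close>

lemma sff_eq_hess:
  assumes c: "is_chart c" "c \<in> \<A>" and x: "immersion \<A> x" and p: "p \<in> dom_of c"
  shows "sff c x p = hess (x \<circ> coord_inv c) (coord c p)"
proof -
  let ?F = "x \<circ> coord_inv c"
  have "inj (frechet_derivative ?F (at (coord c p)))" using x c(2) p by (simp add: immersion_def)
  then obtain \<xi> where "Vol (\<lambda>k. pd k ?F (coord c p)) \<xi> = 1"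
    using inj_derivative_transversal[OF smooth_on_imp_differentiable[OF immersion_smooth[OF x c(2)] imageI[OF p]]]
    by blast
  then have "Vol (\<lambda>k. frame c k x p) \<xi> = 1" by (simp add: frame_eq)
  from sff_eq_Vol[OF this] show ?thesis
    by (simp add: vec_eq_iff hess_def frame_frame_eq[OF c(1) p] frame_eq[of c _ x] Vol_eq_conormal)
qed

lemma laplacian_Blaschke_eq:
  fixes c :: "('m::t2_space, 'n::finite) chart"
  assumes c: "is_chart c" "c \<in> \<A>" and x: "immersion \<A> x" and p: "p \<in> dom_of c"
  shows "(1 / real CARD('n)) *\<^sub>R laplacian c (Blaschke c x) x p = anormal (x \<circ> coord_inv c) (coord c p)"
proof -
  let ?F = "x \<circ> coord_inv c"
  have g: "Blaschke c x q = metric ?F (coord c q)" if "q \<in> dom_of c" for q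
    by (simp add: Blaschke_def metric_def sff_eq_hess[OF c x that])
  have "frame c i (\<lambda>q. sqrt \<bar>det (Blaschke c x q)\<bar> *\<^sub>R
      (\<Sum>j\<in>UNIV. (matrix_inv (Blaschke c x q) $ i $ j) *\<^sub>R frame c j x q)) p =
    pd i (\<lambda>u. sqrt \<bar>det (metric ?F u)\<bar> *\<^sub>R
        (\<Sum>j\<in>UNIV. (matrix_inv (metric ?F u) $ i $ j) *\<^sub>R pd j ?F u)) (coord c p)" for i
    unfolding frame_eq[of c i]
    by (rule pd_cong[OF chart_open(2)[OF c(1)] imageI[OF p]])
      (simp add: g chart_coord_inv(2,3)[OF c(1)] frame_eq)
  then show ?thesis by (simp add: laplacian_def anormal_def g[OF p])
qed

lemma convex_patch_chart:
  assumes c: "is_chart c" "c \<in> \<A>" and x: "immersion \<A> x"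
    and pos: "\<And>q. q \<in> dom_of c \<Longrightarrow> pos_definite (sff c x q)"
  shows "convex_patch (coord c ` dom_of c) (x \<circ> coord_inv c)"
proof
  show "pos_definite (hess (x \<circ> coord_inv c) u)" if "u \<in> coord c ` dom_of c" for u
    using that pos sff_eq_hess[OF c x] by auto
qed (rule chart_open[OF c(1)] immersion_smooth[OF x c(2)])+

lemma transition:
  assumes c: "is_chart c" and d: "is_chart d" and cd: "compatible_charts c d"
  defines "V \<equiv> coord c ` (dom_of c \<inter> dom_of d)" and "\<phi> \<equiv> coord d \<circ> coord_inv c"
  shows "open V" "V \<subseteq> coord c ` dom_of c" "smooth_on V \<phi>"
    "\<And>v. v \<in> V \<Longrightarrow> \<phi> v \<in> coord d ` dom_of d"
    "\<And>v. v \<in> V \<Longrightarrow> (f \<circ> coord_inv c) v = (f \<circ> coord_inv d) (\<phi> v)"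
    "\<And>p. p \<in> dom_of c \<Longrightarrow> \<phi> (coord c p) = coord d p"
  using cd chart_open[OF c] chart_open[OF d]
  by (auto simp: V_def \<phi>_def compatible_charts_def chart_coord_inv[OF c] chart_coord_inv[OF d]
      intro!: chart_open_image[OF c])

lemma convex_patch_subset:
  "convex_patch U F \<Longrightarrow> open V \<Longrightarrow> V \<subseteq> U \<Longrightarrow> convex_patch V F"
  unfolding convex_patch_def by (blast intro: smooth_on_subset)

text \<open>Used with \<open>s\<close> equal to 1 or -1: the identity or the reversal of coordinate
  \<open>m\<close>. A single formula covers both the chart that is kept and the chart whose
  orientation is reversed.\<close>

definition reflect :: "'n::finite \<Rightarrow> real \<Rightarrow> real ^ 'n ^ 'n" where
  "reflect m s = (\<chi> i j. if i = j then (if i = m then s else 1) else 0)"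

lemma reflect_vector: "reflect m s *v u = (\<chi> i. (if i = m then s else 1) * u $ i)"
  by (simp add: vec_eq_iff matrix_vector_mult_def reflect_def if_distrib[of "\<lambda>x. x * _"] cong: if_cong)

lemma reflect_involution:
  assumes "s * s = 1"
  shows "reflect m s *v (reflect m s *v u) = u"
proof -
  have "s * (s * a) = a" for a using assms by (simp add: mult.assoc[symmetric])
  then show ?thesis by (simp add: reflect_vector vec_eq_iff)
qed

lemma det_reflect: "det (reflect m s) = s"
proof -
  have "det (reflect m s) = (\<Prod>i\<in>UNIV. if i = m then s else 1)"
    by (subst det_diagonal) (simp_all add: reflect_def)
  then show ?thesis by simp
qed

lemma transpose_reflect: "transpose (reflect m s) = reflect m s"
  by (simp add: vec_eq_iff transpose_def reflect_def)

lemma jac_reflect: "jac ((*v) (reflect m s)) u = reflect m s"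
proof -
  have "pd i ((*v) (reflect m s)) u = reflect m s *v axis i 1" for i
    by (rule pd_eqI) (rule bounded_linear_imp_has_derivative[OF matrix_vector_mul_bounded_linear])
  then show ?thesis
    by (simp add: vec_eq_iff jac_def matrix_vector_mult_basis column_def) (simp add: reflect_def)
qed

lemma smooth_on_matrix_vector: "smooth_on S ((*v) (A :: real ^ 'n::finite ^ 'n))"
proof -
  have "smooth_on UNIV ((*v) A)"
    unfolding smooth_on_def
  proof
    fix k show "Ck_on k UNIV ((*v) A)"
    proof (cases k)
      case 0
      then show ?thesis by (simp add: linear_continuous_on)
    next
      case (Suc m)
      have "Ck_on (Suc m) UNIV ((*v) A)"
        by (rule Ck_on_SucI[OF open_UNIV bounded_linear_imp_has_derivative[OF matrix_vector_mul_bounded_linear] Ck_on_const])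
      then show ?thesis using Suc by simp
    qed
  qed
  then show ?thesis by (rule smooth_on_subset) simp
qed

section \<open>Oriented charts and the affine normal on a manifold\<close>

locale manifold =
  fixes \<A> :: "('m::{t2_space, second_countable_topology}, 'n::finite) chart set"
  assumes smooth_manifold: "smooth_manifold \<A>"
begin

lemma chart: "c \<in> \<A> \<Longrightarrow> is_chart c"
  using smooth_manifold unfolding smooth_manifold_def by blast

lemma compatible: "c \<in> \<A> \<Longrightarrow> d \<in> \<A> \<Longrightarrow> compatible_charts c d"
  using smooth_manifold unfolding smooth_manifold_def by blast

lemma chart_around: "\<exists>c\<in>\<A>. p \<in> dom_of c"
  using smooth_manifold unfolding smooth_manifold_def by blast

text \<open>Membership comes from maximality of the atlas, so compatibility with every chart has to
  be checked. The reflection is its own inverse, which makes images under the new coordinates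
  preimages under a continuous map.\<close>

lemma restricted_reflected_chart:
  fixes m :: 'n and s :: real
  assumes c: "c \<in> \<A>" and W: "open W" "W \<subseteq> dom_of c" and s: "s * s = 1"
  defines "d \<equiv> (W, \<lambda>p. reflect m s *v coord c p)"
  shows "d \<in> \<A>"
    and "\<And>u. u \<in> coord d ` W \<Longrightarrow> coord_inv d u = coord_inv c (reflect m s *v u)"
proof -
  let ?R = "(*v) (reflect m s)"
  note ch = chart[OF c]
  note RR = reflect_involution[OF s]
  have img: "(\<lambda>p. ?R (coord c p)) ` X = ?R -` (coord c ` X)" for X
  proof (intro equalityI subsetI)
    fix u assume "u \<in> ?R -` (coord c ` X)"
    then obtain p where "p \<in> X" "?R u = coord c p" by auto
    then show "u \<in> (\<lambda>p. ?R (coord c p)) ` X" using RR[of m u] by (intro image_eqI[of _ _ p]) simp_all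
  qed (auto simp: RR)
  have cont: "continuous_on S ?R" for S by (simp add: linear_continuous_on)
  have open_pre: "open (?R -` S)" if "open S" for S
    using open_vimage[OF that cont] .
  have op: "open ((\<lambda>p. ?R (coord c p)) ` X)" if "open X" "X \<subseteq> W" for X
    unfolding img using W(2) that by (intro open_pre chart_open_image[OF ch]) auto
  have inj: "inj_on (\<lambda>p. ?R (coord c p)) W"
  proof (rule inj_on_inverseI)
    show "coord_inv c (?R (?R (coord c p))) = p" if "p \<in> W" for p
      using that W(2) by (auto simp: RR chart_coord_inv(1)[OF ch])
  qed
  show ci: "coord_inv d u = coord_inv c (?R u)" if "u \<in> coord d ` W" for u
  proof -
    obtain p where p: "p \<in> W" "u = ?R (coord c p)" using \<open>u \<in> coord d ` W\<close> by (auto simp: d_def)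
    then have "coord_inv d u = p" by (simp add: coord_inv_def d_def inv_into_f_f[OF inj])
    moreover have "coord_inv c (?R u) = p" using p W(2) by (auto simp: RR chart_coord_inv(1)[OF ch])
    ultimately show ?thesis by simp
  qed
  have dd: "is_chart d"
    unfolding is_chart_def
  proof (intro conjI)
    show "open (dom_of d)" using W by (simp add: d_def)
    show "open (coord d ` dom_of d)" using op[OF W(1)] by (simp add: d_def)
    show "homeomorphism (dom_of d) (coord d ` dom_of d) (coord d) (coord_inv d)"
    proof (rule homeomorphismI)
      show "continuous_on (dom_of d) (coord d)"
        unfolding d_def
        using continuous_on_compose[OF continuous_on_subset[OF chart_open(3)[OF ch] W(2)] cont]
        by (simp add: o_def)
      have "continuous_on (coord d ` W) (coord_inv c \<circ> ?R)"
      proof (rule continuous_on_compose[OF cont])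
        have "?R ` (coord d ` W) \<subseteq> coord c ` dom_of c" using W(2) by (auto simp: d_def RR)
        then show "continuous_on (?R ` (coord d ` W)) (coord_inv c)"
          by (rule continuous_on_subset[OF chart_open(4)[OF ch]])
      qed
      then have "continuous_on (coord d ` W) (coord_inv d)"
        by (rule continuous_on_eq) (simp add: ci)
      then show "continuous_on (coord d ` dom_of d) (coord_inv d)" by (simp add: d_def)
      show "coord_inv d (coord d p) = p" if "p \<in> dom_of d" for p
        using that by (simp add: coord_inv_def d_def inv_into_f_f[OF inj])
      then show "coord_inv d ` coord d ` dom_of d \<subseteq> dom_of d" by auto
      show "coord d (coord_inv d u) = u" if "u \<in> coord d ` dom_of d" for u
        using that by (auto simp: coord_inv_def d_def inv_into_f_f[OF inj])
    qed simp
  qed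
  moreover have "compatible_charts d e" if e: "e \<in> \<A>" for e
    unfolding compatible_charts_def
  proof (intro conjI)
    note che = chart[OF e] and ce = compatible[OF c e, unfolded compatible_charts_def]
    have We: "open (W \<inter> dom_of e)" using W(1) chart_open(1)[OF che] by auto
    let ?V = "coord d ` (W \<inter> dom_of e)"
    have V: "open ?V" using op[OF We] by (simp add: d_def)
    have "smooth_on ?V (\<lambda>u. (coord e \<circ> coord_inv c) (?R u))"
    proof (rule smooth_on_linear_precomp[OF V matrix_vector_mul_bounded_linear _ conjunct1[OF ce]])
      show "?R ` ?V \<subseteq> coord c ` (dom_of c \<inter> dom_of e)" using W(2) by (auto simp: d_def RR)
    qed
    then have "smooth_on ?V (coord e \<circ> coord_inv d)"
      by (rule smooth_on_cong[OF V, rotated]) (auto simp: ci)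
    then show "smooth_on (coord d ` (dom_of d \<inter> dom_of e)) (coord e \<circ> coord_inv d)" by (simp add: d_def)
    have V': "open (coord e ` (W \<inter> dom_of e))" by (rule chart_open_image[OF che We]) simp
    have "smooth_on (coord e ` (W \<inter> dom_of e)) (\<lambda>u. ?R ((coord c \<circ> coord_inv e) u))"
      by (rule smooth_on_bounded_linear_comp[OF V' matrix_vector_mul_bounded_linear
            smooth_on_subset[OF conjunct2[OF ce]]]) (use W(2) in auto)
    then show "smooth_on (coord e ` (dom_of d \<inter> dom_of e)) (coord d \<circ> coord_inv e)"
      by (simp add: d_def o_def)
  qed
  ultimately show "d \<in> \<A>"
    using smooth_manifold unfolding smooth_manifold_def by blast
qed

text \<open>The change of coordinates by \<open>reflect m s\<close> turns h into \<open>s\<close>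
  times a congruent matrix. With \<open>s\<close> the sign of the definite form, the result is
  positive definite.\<close>

lemma oriented_chart_exists:
  assumes x: "locally_strongly_convex \<A> x"
  shows "\<exists>c\<in>\<A>. p \<in> dom_of c \<and> (\<forall>q\<in>dom_of c. pos_definite (sff c x q))"
proof -
  obtain c where c: "c \<in> \<A>" "p \<in> dom_of c" using chart_around by blast
  note ch = chart[OF c(1)]
  have imm: "immersion \<A> x" using x by (simp add: locally_strongly_convex_def)
  note sff = sff_eq_hess[OF ch c(1) imm]
  \<comment> \<open>Any index serves: a diagonal entry of a definite matrix shows its sign.\<close>
  fix m :: 'n
  have ax: "axis m 1 \<bullet> (A *v axis m 1) = A $ m $ m" for A :: "real ^ 'n ^ 'n"
    by (simp add: inner_axis' matrix_vector_mult_basis column_def)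
  have defi: "pos_definite (sff c x q) \<or> pos_definite (- sff c x q)" if "q \<in> dom_of c" for q
    using x c(1) that by (simp add: locally_strongly_convex_def)
  have diag: "pos_definite A \<Longrightarrow> A $ m $ m > 0" for A :: "real ^ 'n ^ 'n"
    using ax[of A] by (metis axis_eq_0_iff pos_definite_def zero_neq_one)
  define s where "s = sgn (sff c x p $ m $ m)"
  have nz: "sff c x p $ m $ m \<noteq> 0" using defi[OF c(2)] diag by force
  then have s: "s * s = 1" by (auto simp: s_def sgn_if)
  \<comment> \<open>The sign may differ between components of the chart domain, so the domain is cut
    down to the open part where it is the sign at \<open>p\<close>.\<close>
  define W where "W = {q \<in> dom_of c. 0 < s * sff c x q $ m $ m}"
  have "continuous_on (dom_of c) (\<lambda>q. s * hess (x \<circ> coord_inv c) (coord c q) $ m $ m)"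
  proof -
    let ?U = "coord c ` dom_of c" and ?F = "x \<circ> coord_inv c"
    have F: "smooth_on ?U ?F" by (rule immersion_smooth[OF imm c(1)])
    have "smooth_on ?U (\<lambda>u. s * (conormal ?F u \<bullet> pd m (pd m ?F) u))"
      using chart_open(2)[OF ch] F
      by (intro smooth_on_mult smooth_on_const smooth_on_inner smooth_on_conormal smooth_on_pd)
    from continuous_on_compose[OF chart_open(3)[OF ch] smooth_on_imp_continuous_on[OF this]]
    show ?thesis by (simp add: hess_def o_def)
  qed
  from continuous_open_preimage[OF this chart_open(1)[OF ch] open_greaterThan[of 0]]
  have "open {q \<in> dom_of c. 0 < s * hess (x \<circ> coord_inv c) (coord c q) $ m $ m}"
    by (simp add: vimage_def Int_def)
  moreover have "W = {q \<in> dom_of c. 0 < s * hess (x \<circ> coord_inv c) (coord c q) $ m $ m}"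
    unfolding W_def using sff by auto
  ultimately have W: "open W" "W \<subseteq> dom_of c" by (auto simp: W_def)
  have pW: "p \<in> W" using c(2) nz by (simp add: W_def s_def sgn_if)
  let ?R = "reflect m s"
  define d where "d = (W, \<lambda>p. ?R *v coord c p)"
  have d: "d \<in> \<A>" and ci: "\<And>u. u \<in> coord d ` W \<Longrightarrow> coord_inv d u = coord_inv c (?R *v u)"
    using restricted_reflected_chart[OF c(1) W s, where m = m] unfolding d_def by auto
  have "pos_definite (sff d x q)" if q: "q \<in> W" for q
  proof -
    have dom: "dom_of d = W" by (simp add: d_def)
    have oV: "open (coord d ` W)" using chart_open(2)[OF chart[OF d]] dom by simp
    have "hess (x \<circ> coord_inv d) (coord d q) = det (jac ((*v) ?R) (coord d q)) *\<^sub>R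
        (jac ((*v) ?R) (coord d q) ** hess (x \<circ> coord_inv c) (?R *v coord d q) ** transpose (jac ((*v) ?R) (coord d q)))"
    proof (rule hess_comp[OF oV imageI[OF q]])
      show "(x \<circ> coord_inv d) y = (x \<circ> coord_inv c) (?R *v y)" if "y \<in> coord d ` W" for y
        using ci[OF that] by simp
      show "?R *v y \<in> coord c ` dom_of c" if "y \<in> coord d ` W" for y
        using that W(2) by (auto simp: d_def reflect_involution[OF s])
    qed (rule smooth_on_matrix_vector immersion_smooth[OF imm c(1)])+
    moreover have "?R *v coord d q = coord c q" by (simp add: d_def reflect_involution[OF s])
    moreover have "q \<in> dom_of c" using q W(2) by blast
    ultimately have h: "sff d x q = s *\<^sub>R (?R ** sff c x q ** transpose ?R)"
      using sff_eq_hess[OF chart[OF d] d imm] sff q dom by (simp add: jac_reflect det_reflect)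
    have pd: "0 < s * (w \<bullet> (sff c x q *v w))" if "w \<noteq> 0" for w
    proof -
      have sg: "s = 1 \<or> s = -1" using s by (simp add: square_eq_1_iff)
      have pos: "0 < s * sff c x q $ m $ m" using q by (simp add: W_def)
      from defi[OF \<open>q \<in> dom_of c\<close>] show ?thesis
      proof
        assume P: "pos_definite (sff c x q)"
        then have "s = 1" using diag[OF P] pos sg by auto
        then show ?thesis using P that by (simp add: pos_definite_def)
      next
        assume P: "pos_definite (- sff c x q)"
        then have "s = -1" using diag[OF P] pos sg by auto
        moreover have "0 < w \<bullet> ((- sff c x q) *v w)" using P that by (simp add: pos_definite_def)
        moreover have "(- sff c x q) *v w = - (sff c x q *v w)"
          by (simp add: vec_eq_iff matrix_vector_mult_def sum_negf)
        ultimately show ?thesis by simp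
      qed
    qed
    show ?thesis
      unfolding pos_definite_def
    proof (intro allI impI)
      fix v :: "real ^ 'n" assume "v \<noteq> 0"
      then have "?R *v v \<noteq> 0" using reflect_involution[OF s, of m v] by auto
      from pd[OF this] show "0 < v \<bullet> (sff d x q *v v)"
        unfolding h scaleR_matrix_vector_assoc[symmetric] inner_scaleR_right
          transpose_reflect inner_matrix_congruence[of v ?R, unfolded transpose_reflect] .
    qed
  qed
  then show ?thesis using d pW by (intro bexI[of _ d]) (auto simp: d_def)
qed

lemma oriented_chart_props:
  assumes x: "locally_strongly_convex \<A> x"
  shows "oriented_chart \<A> x p \<in> \<A>" "p \<in> dom_of (oriented_chart \<A> x p)"
    "\<And>q. q \<in> dom_of (oriented_chart \<A> x p) \<Longrightarrow> pos_definite (sff (oriented_chart \<A> x p) x q)"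
proof -
  have "\<exists>c. c \<in> \<A> \<and> p \<in> dom_of c \<and> (\<forall>q\<in>dom_of c. pos_definite (sff c x q))"
    using oriented_chart_exists[OF x, of p] by blast
  from someI_ex[OF this]
  show "oriented_chart \<A> x p \<in> \<A>" "p \<in> dom_of (oriented_chart \<A> x p)"
    "\<And>q. q \<in> dom_of (oriented_chart \<A> x p) \<Longrightarrow> pos_definite (sff (oriented_chart \<A> x p) x q)"
    unfolding oriented_chart_def by blast+
qed

text \<open>The chart behind the left side varies with \<open>p\<close>, the one on the right is
  fixed. This is where the affine normal becomes a smooth field that can be differentiated.\<close>

lemma affine_normal_eq:
  assumes x: "locally_strongly_convex \<A> x" and c: "c \<in> \<A>"
    and pos: "\<And>q. q \<in> dom_of c \<Longrightarrow> pos_definite (sff c x q)" and p: "p \<in> dom_of c"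
  shows "affine_normal \<A> x p = anormal (x \<circ> coord_inv c) (coord c p)"
proof -
  have imm: "immersion \<A> x" using x by (simp add: locally_strongly_convex_def)
  define d where "d = oriented_chart \<A> x p"
  note d = oriented_chart_props[OF x, where p = p, folded d_def]
  note t = transition[OF chart[OF d(1)] chart[OF c] compatible[OF d(1) c]]
  have "affine_normal \<A> x p = anormal (x \<circ> coord_inv d) (coord d p)"
    unfolding affine_normal_def Let_def d_def[symmetric]
    by (rule laplacian_Blaschke_eq[OF chart[OF d(1)] d(1) imm d(2)])
  also have "\<dots> = anormal (x \<circ> coord_inv c) ((coord c \<circ> coord_inv d) (coord d p))"
    using d(2) p
    by (intro anormal_comp[OF convex_patch_chart[OF chart[OF c] c imm pos]
          convex_patch_subset[OF convex_patch_chart[OF chart[OF d(1)] d(1) imm d(3)] t(1,2)] t(5,4,3)]) auto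
  finally show ?thesis using t(6)[OF d(2)] by simp
qed

text \<open>The chart \<open>c\<close> may have either orientation. Near each point the field is
  given by an oriented chart, and the conormals of the two charts are proportional, so tangency of
  the derivatives carries over. This generality lets \<open>orientation\<close> compare the members
  of a family in an arbitrary chart.\<close>

lemma affine_normal_any_chart:
  assumes x: "locally_strongly_convex \<A> x" and c: "c \<in> \<A>" and u: "u \<in> coord c ` dom_of c"
  shows "(affine_normal \<A> x \<circ> coord_inv c) differentiable (at u)"
    and "conormal (x \<circ> coord_inv c) u \<bullet> pd k (affine_normal \<A> x \<circ> coord_inv c) u = 0"
proof -
  have imm: "immersion \<A> x" using x by (simp add: locally_strongly_convex_def)
  define p where "p = coord_inv c u"
  have p: "p \<in> dom_of c" "coord c p = u" using chart_coord_inv[OF chart[OF c]] u by (auto simp: p_def)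
  define d where "d = oriented_chart \<A> x p"
  note d = oriented_chart_props[OF x, where p = p, folded d_def]
  interpret D: convex_patch "coord d ` dom_of d" "x \<circ> coord_inv d"
    by (rule convex_patch_chart[OF chart[OF d(1)] d(1) imm d(3)])
  let ?V = "coord c ` (dom_of c \<inter> dom_of d)" and ?\<phi> = "coord d \<circ> coord_inv c"
  note t = transition[OF chart[OF c] chart[OF d(1)] compatible[OF c d(1)]]
  have uV: "u \<in> ?V" using p d(2) by auto
  have \<phi>: "?\<phi> differentiable (at u)" by (rule smooth_on_imp_differentiable[OF t(3) uV])
  have A: "anormal (x \<circ> coord_inv d) differentiable (at (?\<phi> u))"
    by (rule smooth_on_imp_differentiable[OF D.smooth_anormal t(4)[OF uV]])
  have eq: "anormal (x \<circ> coord_inv d) (?\<phi> v) = (affine_normal \<A> x \<circ> coord_inv c) v" if "v \<in> ?V" for v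
  proof -
    obtain q where q: "q \<in> dom_of c" "q \<in> dom_of d" "v = coord c q" using \<open>v \<in> ?V\<close> by auto
    then show ?thesis
      using affine_normal_eq[OF x d(1) d(3) q(2)] by (simp add: chart_coord_inv[OF chart[OF c]])
  qed
  show "(affine_normal \<A> x \<circ> coord_inv c) differentiable (at u)"
    by (rule differentiable_cong_open[OF t(1) uV _ differentiable_chain_at[OF \<phi> A]])
      (simp only: eq o_apply[of "anormal (x \<circ> coord_inv d)"])
  have "conormal (x \<circ> coord_inv c) u = det (jac ?\<phi> u) *\<^sub>R conormal (x \<circ> coord_inv d) (?\<phi> u)"
    by (rule conormal_comp[OF t(1) uV t(5) \<phi> smooth_on_imp_differentiable[OF D.smooth_F t(4)[OF uV]]])
  moreover have "pd k (affine_normal \<A> x \<circ> coord_inv c) u =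
      (\<Sum>j\<in>UNIV. jac ?\<phi> u $ k $ j *\<^sub>R pd j (anormal (x \<circ> coord_inv d)) (?\<phi> u))"
    by (rule pd_comp[OF t(1) uV eq[symmetric] \<phi> A])
  ultimately show "conormal (x \<circ> coord_inv c) u \<bullet> pd k (affine_normal \<A> x \<circ> coord_inv c) u = 0"
    by (simp add: inner_sum_right D.N_pd_anormal[OF t(4)[OF uV], unfolded o_def] o_def)
qed

end

section \<open>Families of equiaffine parallel hypersurfaces\<close>

lemma continuous_nonzero_same_sign:
  fixes g :: "real \<Rightarrow> real"
  assumes c: "continuous_on S g" and nz: "\<And>s. s \<in> S \<Longrightarrow> g s \<noteq> 0" and S: "connected S" and ab: "a \<in> S" "b \<in> S"
    and pos: "g a > 0"
  shows "g b > 0"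
proof (rule ccontr)
  assume "\<not> g b > 0"
  then have "g b \<le> 0" by simp
  moreover have "connected (g ` S)" by (rule connected_continuous_image[OF c S])
  ultimately have "0 \<in> g ` S" using ab pos unfolding connected_iff_interval
    by (meson imageI less_imp_le)
  then show False using nz by auto
qed

lemma continuous_on_det_affine:
  fixes B :: "real ^ 'n::finite ^ 'n"
  shows "continuous_on S (\<lambda>t. det (mat 1 - t *\<^sub>R B))"
  unfolding det_def by (intro continuous_intros)

text \<open>Jacobi's formula in the variable \<open>t\<close>: the derivative of the pencil is -B,
  written as \<open>C\<close> times the pencil itself.\<close>

lemma has_derivative_det_pencil:
  fixes B C :: "real ^ 'n::finite ^ 'n"
  assumes C: "C ** (mat 1 - t *\<^sub>R B) = - B"
  shows "((\<lambda>t. det (mat 1 - t *\<^sub>R B)) has_real_derivative trace C * det (mat 1 - t *\<^sub>R B)) (at t)"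
proof -
  have "((\<lambda>t. det (mat 1 - t *\<^sub>R B)) has_derivative
      (\<lambda>v. \<Sum>r\<in>UNIV. det (\<chi> i. if i = r then (v *\<^sub>R - B) $ r else (mat 1 - t *\<^sub>R B) $ i))) (at t)"
  proof (rule has_derivative_det)
    show "((\<lambda>t. (mat 1 - t *\<^sub>R B) $ i $ j) has_derivative (\<lambda>v. (v *\<^sub>R - B) $ i $ j)) (at t)" for i j
      by (auto intro!: derivative_eq_intros)
  qed
  moreover have "v *\<^sub>R - B = (v *\<^sub>R C) ** (mat 1 - t *\<^sub>R B)" for v
    using matrix_scaleR_mult[of v C 1 "mat 1 - t *\<^sub>R B"] C by simp
  ultimately have "((\<lambda>t. det (mat 1 - t *\<^sub>R B)) has_derivative
      (\<lambda>v. trace (v *\<^sub>R C) * det (mat 1 - t *\<^sub>R B))) (at t)"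
    by (simp only: sum_det_replace_row)
  moreover have "(\<lambda>v. trace (v *\<^sub>R C) * det (mat 1 - t *\<^sub>R B)) = (*) (trace C * det (mat 1 - t *\<^sub>R B))"
    by (rule ext) (simp add: trace_def sum_distrib_left[symmetric])
  ultimately show ?thesis by (simp only: has_field_derivative_def)
qed

text \<open>The points with parameters 0 and 1 on the second line differ by \<open>Y\<close>, and as
  translates of points of the first line they differ by a multiple of \<open>Z\<close>. The
  coefficient is nonzero since \<open>Y\<close> is, so it can be inverted.\<close>

lemma affine_parallel_lines:
  fixes a b Y Z :: "'a::real_vector"
  assumes "affine_parallel {a + t *\<^sub>R Z | t. True} {b + t *\<^sub>R Y | t. True}" and "Y \<noteq> 0"
  shows "\<exists>f. Z = f *\<^sub>R Y"
proof -
  obtain e where e: "{b + t *\<^sub>R Y | t. True} = (+) e ` {a + t *\<^sub>R Z | t. True}"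
    using assms(1) unfolding affine_parallel_def by blast
  have "\<exists>s. b + r *\<^sub>R Y = e + (a + s *\<^sub>R Z)" for r
  proof -
    have "b + r *\<^sub>R Y \<in> (+) e ` {a + t *\<^sub>R Z | t. True}"
      unfolding e[symmetric] by blast
    then show ?thesis by blast
  qed
  from this[of 0] this[of 1] obtain s0 s1
    where s: "b + 0 *\<^sub>R Y = e + (a + s0 *\<^sub>R Z)" "b + 1 *\<^sub>R Y = e + (a + s1 *\<^sub>R Z)"
    by blast
  have "Y = (b + 1 *\<^sub>R Y) - (b + 0 *\<^sub>R Y)" by simp
  also have "\<dots> = (s1 - s0) *\<^sub>R Z"
    unfolding s by (simp add: scaleR_diff_left)
  finally have Y: "Y = (s1 - s0) *\<^sub>R Z" .
  then have "s1 - s0 \<noteq> 0" using assms(2) by auto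
  then have "Z = (1 / (s1 - s0)) *\<^sub>R Y" unfolding Y by simp
  then show ?thesis ..
qed

context manifold
begin

lemma shape_exists:
  assumes x: "locally_strongly_convex \<A> x" and c: "c \<in> \<A>" and p: "p \<in> dom_of c"
  shows "\<exists>B. \<forall>i. pd i (affine_normal \<A> x \<circ> coord_inv c) (coord c p) =
    - (\<Sum>j\<in>UNIV. B $ i $ j *\<^sub>R pd j (x \<circ> coord_inv c) (coord c p))"
proof -
  have imm: "immersion \<A> x" using x by (simp add: locally_strongly_convex_def)
  let ?F = "x \<circ> coord_inv c" and ?Y = "affine_normal \<A> x \<circ> coord_inv c" and ?u = "coord c p"
  have u: "?u \<in> coord c ` dom_of c" using p by blast
  have "inj (frechet_derivative ?F (at ?u))" using imm c p by (simp add: immersion_def)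
  then obtain \<xi> where \<xi>: "Vol (\<lambda>k. pd k ?F ?u) \<xi> = 1"
    using inj_derivative_transversal[OF smooth_on_imp_differentiable[OF immersion_smooth[OF imm c] u]] by blast
  have "\<exists>\<Gamma>. pd i ?Y ?u = (\<Sum>k\<in>UNIV. \<Gamma> k *\<^sub>R pd k ?F ?u)" for i
    using Vol_decomp_exists[OF \<xi>, of "pd i ?Y ?u"] affine_normal_any_chart(2)[OF x c u, of i]
    by (simp add: Vol_eq_conormal)
  then have "\<forall>i. \<exists>\<Gamma>. pd i ?Y ?u = (\<Sum>k\<in>UNIV. \<Gamma> k *\<^sub>R pd k ?F ?u)" ..
  from choice[OF this] obtain \<Gamma> where \<Gamma>: "\<forall>i. pd i ?Y ?u = (\<Sum>k\<in>UNIV. \<Gamma> i k *\<^sub>R pd k ?F ?u)"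
    by blast
  show ?thesis
    by (rule exI[of _ "\<chi> i j. - \<Gamma> i j"]) (use \<Gamma> in \<open>simp add: sum_negf\<close>)
qed

text \<open>Injectivity of the derivative makes the frame independent, so any matrix satisfying the
  defining equation is the one described.\<close>

lemma shape_operator_eqI:
  assumes x: "immersion \<A> x" and c: "c \<in> \<A>" and p: "p \<in> dom_of c"
    and B: "\<And>i. pd i (affine_normal \<A> x \<circ> coord_inv c) (coord c p) =
      - (\<Sum>j\<in>UNIV. B $ i $ j *\<^sub>R pd j (x \<circ> coord_inv c) (coord c p))"
  shows "shape_operator \<A> c x p = B"
  unfolding shape_operator_def frame_eq
proof (rule the_equality)
  show "\<forall>i. pd i (affine_normal \<A> x \<circ> coord_inv c) (coord c p) =
      - (\<Sum>j\<in>UNIV. B $ i $ j *\<^sub>R pd j (x \<circ> coord_inv c) (coord c p))" using B by blast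
  fix A :: "real ^ 'n ^ 'n"
  let ?F = "x \<circ> coord_inv c" and ?u = "coord c p"
  assume A: "\<forall>i. pd i (affine_normal \<A> x \<circ> coord_inv c) ?u = - (\<Sum>j\<in>UNIV. A $ i $ j *\<^sub>R pd j ?F ?u)"
  have d: "?F differentiable (at ?u)"
    by (rule smooth_on_imp_differentiable[OF immersion_smooth[OF x c] imageI[OF p]])
  have inj: "inj (frechet_derivative ?F (at ?u))" using x c p by (simp add: immersion_def)
  have "A $ i = B $ i" for i
  proof -
    have "frechet_derivative ?F (at ?u) (A $ i) = frechet_derivative ?F (at ?u) (B $ i)"
      using A[rule_format, of i] unfolding B[of i] frechet_derivative_eq_sum_pd[OF d] by simp
    then show ?thesis using inj by (simp only: inj_eq)
  qed
  then show "A = B" by (simp add: vec_eq_iff)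
qed

lemma affine_normal_nonzero:
  assumes x: "locally_strongly_convex \<A> x"
  shows "affine_normal \<A> x p \<noteq> 0"
proof
  have imm: "immersion \<A> x" using x by (simp add: locally_strongly_convex_def)
  define c where "c = oriented_chart \<A> x p"
  note c = oriented_chart_props[OF x, where p = p, folded c_def]
  interpret C: convex_patch "coord c ` dom_of c" "x \<circ> coord_inv c"
    by (rule convex_patch_chart[OF chart[OF c(1)] c(1) imm c(3)])
  assume "affine_normal \<A> x p = 0"
  then have "anormal (x \<circ> coord_inv c) (coord c p) = 0"
    using affine_normal_eq[OF x c(1,3,2)] by simp
  then show False using C.N_anormal[OF imageI[OF c(2)]] C.rho_pos[OF imageI[OF c(2)]] by simp
qed

end

section \<open>The family x + t Y on a connected manifold\<close>

locale parallel_family = manifold \<A> for \<A> :: "('m::{t2_space, second_countable_topology}, 'n::finite) chart set" +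
  fixes x :: "'m \<Rightarrow> real ^ 'n option" and \<delta> :: real
  assumes \<delta>: "\<delta> > 0" and family: "equiaffine_parallel_family \<A> x \<delta>"
    and connected: "connected (UNIV :: 'm set)"
begin

abbreviation "Y \<equiv> affine_normal \<A> x"
abbreviation "xt t \<equiv> shifted \<A> x (\<lambda>_. t)"
abbreviation "I \<equiv> {-\<delta><..<\<delta>}"

lemma lsc: "locally_strongly_convex \<A> x"
  using family by (simp add: equiaffine_parallel_family_def)

lemma lsc_t: "t \<in> I \<Longrightarrow> locally_strongly_convex \<A> (xt t)"
  using family unfolding equiaffine_parallel_family_def equiaffine_parallel_hypersurface_def
    parallel_hypersurface_def by blast

lemma imm: "immersion \<A> x" and imm_t: "t \<in> I \<Longrightarrow> immersion \<A> (xt t)"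
  using lsc lsc_t by (auto simp: locally_strongly_convex_def)

lemma zero_I: "0 \<in> I" using \<delta> by simp

abbreviation "B c p \<equiv> shape_operator \<A> c x p"
abbreviation "M c p t \<equiv> mat 1 - t *\<^sub>R B c p"

lemma pd_Y:
  assumes c: "c \<in> \<A>" and p: "p \<in> dom_of c"
  shows "pd i (Y \<circ> coord_inv c) (coord c p) =
    - (\<Sum>j\<in>UNIV. B c p $ i $ j *\<^sub>R pd j (x \<circ> coord_inv c) (coord c p))"
proof -
  obtain A where A: "\<And>i. pd i (Y \<circ> coord_inv c) (coord c p) =
    - (\<Sum>j\<in>UNIV. A $ i $ j *\<^sub>R pd j (x \<circ> coord_inv c) (coord c p))"
    using shape_exists[OF lsc c p] by blast
  show ?thesis unfolding shape_operator_eqI[OF imm c p A] by (rule A)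
qed

lemma shifted_chart:
  assumes t: "t \<in> I" and c: "c \<in> \<A>" and p: "p \<in> dom_of c"
  shows "pd i (xt t \<circ> coord_inv c) (coord c p) =
      (\<Sum>j\<in>UNIV. M c p t $ i $ j *\<^sub>R pd j (x \<circ> coord_inv c) (coord c p))"
    and "conormal (xt t \<circ> coord_inv c) (coord c p) = det (M c p t) *\<^sub>R conormal (x \<circ> coord_inv c) (coord c p)"
    and "sff c (xt t) p = det (M c p t) *\<^sub>R (M c p t ** sff c x p)"
proof -
  note pp = parallel_patch[OF chart_open(2)[OF chart[OF c]] imageI[OF p] immersion_smooth[OF imm c]
      affine_normal_any_chart[OF lsc c] immersion_smooth[OF imm_t[OF t] c] _ pd_Y[OF c p], of t]
  have sh: "(xt t \<circ> coord_inv c) q = (x \<circ> coord_inv c) q + t *\<^sub>R (Y \<circ> coord_inv c) q" for q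
    by (simp add: shifted_def)
  show "pd i (xt t \<circ> coord_inv c) (coord c p) =
      (\<Sum>j\<in>UNIV. M c p t $ i $ j *\<^sub>R pd j (x \<circ> coord_inv c) (coord c p))"
    by (rule pp(1)[OF _ _ sh])
  show "conormal (xt t \<circ> coord_inv c) (coord c p) = det (M c p t) *\<^sub>R conormal (x \<circ> coord_inv c) (coord c p)"
    by (rule pp(2)[OF _ _ sh])
  show "sff c (xt t) p = det (M c p t) *\<^sub>R (M c p t ** sff c x p)"
    unfolding sff_eq_hess[OF chart[OF c] c imm p] sff_eq_hess[OF chart[OF c] c imm_t[OF t] p]
    by (rule pp(3)[OF _ _ sh])
qed

text \<open>The value is 1 at t = 0, and a zero at some \<open>s\<close> would make the conormal of
  \<open>xt s\<close> vanish although \<open>xt s\<close> is an immersion.\<close>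

lemma det_M_pos:
  assumes t: "t \<in> I" and c: "c \<in> \<A>" and p: "p \<in> dom_of c"
  shows "det (M c p t) > 0"
proof (rule continuous_nonzero_same_sign[OF continuous_on_det_affine, where S = I and a = 0])
  show "det (M c p s) \<noteq> 0" if s: "s \<in> I" for s
  proof
    assume 0: "det (M c p s) = 0"
    let ?G = "xt s \<circ> coord_inv c"
    have "inj (frechet_derivative ?G (at (coord c p)))"
      using imm_t[OF s] c p by (simp add: immersion_def)
    then obtain \<xi> where "Vol (\<lambda>k. pd k ?G (coord c p)) \<xi> = 1"
      using inj_derivative_transversal[OF smooth_on_imp_differentiable[OF immersion_smooth[OF imm_t[OF s] c] imageI[OF p]]]
      by blast
    then show False by (simp add: Vol_eq_conormal shifted_chart(2)[OF s c p] 0)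
  qed
qed (use t zero_I in auto)

text \<open>Definiteness along the whole family rules out a sign change of \<open>v \<bullet> h_t v\<close> in \<open>t\<close>, so the members
  share their oriented charts.\<close>

lemma orientation:
  assumes s: "s \<in> I" and t: "t \<in> I" and c: "c \<in> \<A>" and p: "p \<in> dom_of c"
    and pos: "pos_definite (sff c (xt s) p)"
  shows "pos_definite (sff c (xt t) p)"
  unfolding pos_definite_def
proof (intro allI impI)
  fix v :: "real ^ 'n" assume v: "v \<noteq> 0"
  let ?g = "\<lambda>t. v \<bullet> ((det (M c p t) *\<^sub>R (M c p t ** sff c x p)) *v v)"
  have g: "?g t = v \<bullet> (sff c (xt t) p *v v)" if "t \<in> I" for t
    by (simp only: shifted_chart(3)[OF that c p])
  have "0 < ?g t"
  proof (rule continuous_nonzero_same_sign[where S = I and a = s and g = ?g])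
    have "?g t = det (M c p t) * (v \<bullet> (sff c x p *v v) - t * (v \<bullet> (B c p *v (sff c x p *v v))))" for t
      by (simp add: scaleR_matrix_vector_assoc[symmetric] matrix_vector_mul_assoc[symmetric]
          matrix_vector_mult_diff_rdistrib inner_diff_right)
    then show "continuous_on I ?g"
      by (simp only:) (intro continuous_intros continuous_on_det_affine)
    show "?g r \<noteq> 0" if "r \<in> I" for r
    proof -
      have "pos_definite (sff c (xt r) p) \<or> pos_definite (- sff c (xt r) p)"
        using lsc_t[OF that] c p by (simp add: locally_strongly_convex_def)
      moreover have "(- A) *v v = - (A *v v)" for A :: "real ^ 'n ^ 'n"
        by (simp add: vec_eq_iff matrix_vector_mult_def sum_negf)
      ultimately show ?thesis unfolding g[OF that] pos_definite_def using v by force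
    qed
    show "0 < ?g s" unfolding g[OF s] using pos v by (simp add: pos_definite_def)
  qed (use s t in auto)
  then show "0 < v \<bullet> (sff c (xt t) p *v v)" by (simp only: g[OF t])
qed

lemma shifted_zero: "xt 0 = x"
  by (simp add: shifted_def fun_eq_iff)

text \<open>The factor f_t of the overview. Writing it as a Euclidean quotient gives it
  differentiability in the point directly from that of the two normals.\<close>

definition normal_ratio where "normal_ratio t p = (affine_normal \<A> (xt t) p \<bullet> Y p) / (Y p \<bullet> Y p)"

lemma affine_normal_shifted:
  assumes t: "t \<in> I"
  shows "affine_normal \<A> (xt t) p = normal_ratio t p *\<^sub>R Y p"
proof -
  have "affine_parallel (affine_normal_line \<A> (xt t) p) (affine_normal_line \<A> x p)"
    using family t unfolding equiaffine_parallel_family_def equiaffine_parallel_hypersurface_def by blast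
  then obtain a where a: "affine_normal \<A> (xt t) p = a *\<^sub>R Y p"
    using affine_parallel_lines[OF _ affine_normal_nonzero[OF lsc]] unfolding affine_normal_line_def by blast
  moreover have "normal_ratio t p = a" using affine_normal_nonzero[OF lsc, of p] by (simp add: normal_ratio_def a)
  ultimately show ?thesis by simp
qed

lemma normal_ratio_locally_constant:
  assumes t: "t \<in> I"
  shows "\<exists>T. open T \<and> p \<in> T \<and> (\<forall>q\<in>T. normal_ratio t q = normal_ratio t p)"
proof -
  define c where "c = oriented_chart \<A> x p"
  note c = oriented_chart_props[OF lsc, where p = p, folded c_def]
  note ch = chart[OF c(1)]
  let ?U = "coord c ` dom_of c" and ?F = "x \<circ> coord_inv c" and ?Y = "Y \<circ> coord_inv c"
    and ?Z = "affine_normal \<A> (xt t) \<circ> coord_inv c" and ?f = "normal_ratio t \<circ> coord_inv c"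
  interpret C: convex_patch ?U ?F
    by (rule convex_patch_chart[OF ch c(1) imm c(3)])
  have dY: "?Y differentiable (at u)" and dZ: "?Z differentiable (at u)" if "u \<in> ?U" for u
    using affine_normal_any_chart(1)[OF lsc c(1) that] affine_normal_any_chart(1)[OF lsc_t[OF t] c(1) that] .
  have df: "?f differentiable (at u)" if "u \<in> ?U" for u
  proof -
    have "(\<lambda>u. (?Z u \<bullet> ?Y u) / (?Y u \<bullet> ?Y u)) differentiable (at u)"
      using affine_normal_nonzero[OF lsc]
      by (intro differentiable_divide differentiable_inner dY[OF that] dZ[OF that]) simp
    then show ?thesis by (simp add: normal_ratio_def[abs_def] o_def)
  qed
  have pd0: "pd i ?f u = 0" if u: "u \<in> ?U" for i u
  proof -
    obtain q where q: "q \<in> dom_of c" "u = coord c q" using u by blast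
    have "?Z = (\<lambda>u. ?f u *\<^sub>R ?Y u)" by (simp add: affine_normal_shifted[OF t] fun_eq_iff)
    then have "pd i ?Z u = ?f u *\<^sub>R pd i ?Y u + pd i ?f u *\<^sub>R ?Y u"
      by (simp only: pd_scaleR[OF df[OF u] dY[OF u]])
    moreover have "conormal ?F u \<bullet> pd i ?Y u = 0"
      by (rule affine_normal_any_chart(2)[OF lsc c(1) u])
    moreover have "conormal (xt t \<circ> coord_inv c) u \<bullet> pd i ?Z u = 0"
      by (rule affine_normal_any_chart(2)[OF lsc_t[OF t] c(1) u])
    \<comment> \<open>Tangency to \<open>xt t\<close> is tangency to \<open>x\<close>, since the
      conormals differ by the positive factor det (I - t B).\<close>
    then have "conormal ?F u \<bullet> pd i ?Z u = 0"
      using shifted_chart(2)[OF t c(1) q(1)] det_M_pos[OF t c(1) q(1)] by (simp add: q(2))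
    moreover have "conormal ?F u \<bullet> ?Y u = rho ?F u"
      using affine_normal_eq[OF lsc c(1,3) q(1)] C.N_anormal[OF u] by (simp add: q chart_coord_inv(1)[OF ch q(1)])
    ultimately show ?thesis using C.rho_pos[OF u] by (simp add: inner_add_right)
  qed
  obtain e where e: "e > 0" "ball (coord c p) e \<subseteq> ?U"
    using C.open_U c(2) open_contains_ball by blast
  have "\<exists>a. \<forall>u\<in>ball (coord c p) e. ?f u = a"
  proof -
    have "(?f has_derivative (\<lambda>v. 0)) (at u within ball (coord c p) e)" if "u \<in> ball (coord c p) e" for u
    proof -
      have u: "u \<in> ?U" using that e by blast
      have "frechet_derivative ?f (at u) = (\<lambda>v. 0)"
        by (rule ext) (simp add: frechet_derivative_eq_sum_pd[OF df[OF u]] pd0[OF u] del: o_apply)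
      then show ?thesis using frechet_derivativeI[OF df[OF u]] by (auto intro: has_derivative_at_withinI)
    qed
    then show ?thesis using has_derivative_zero_constant[OF convex_ball, of "coord c p" e ?f] by blast
  qed
  then obtain a where a: "\<And>u. u \<in> ball (coord c p) e \<Longrightarrow> ?f u = a" by blast
  let ?T = "dom_of c \<inter> coord c -` ball (coord c p) e"
  have "open ?T" by (rule continuous_open_preimage[OF chart_open(3,1)[OF ch] open_ball])
  moreover have "normal_ratio t q = a" if "q \<in> ?T" for q
    using a[of "coord c q"] that by (simp add: chart_coord_inv(1)[OF ch])
  moreover have "p \<in> ?T" using c(2) e(1) by simp
  ultimately show ?thesis by (intro exI[of _ ?T]) auto
qed

lemma normal_ratio_constant:
  assumes t: "t \<in> I"
  shows "normal_ratio t p = normal_ratio t q"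
proof -
  have "normal_ratio t constant_on UNIV"
    by (rule locally_constant_imp_constant[OF connected]) (use normal_ratio_locally_constant[OF t] in simp)
  then show ?thesis by (auto simp: constant_on_def)
qed

text \<open>The chart is positively oriented for both \<open>x\<close> and \<open>xt t\<close>, so
  rho and det h can be compared in it; their positivity gives the sign of the ratio and allows the
  common powers of det (I - t B) to be cancelled.\<close>

lemma det_M_eq:
  assumes t: "t \<in> I" and c: "c \<in> \<A>" and p: "p \<in> dom_of c"
    and pos: "\<And>q. q \<in> dom_of c \<Longrightarrow> pos_definite (sff c x q)"
  shows "normal_ratio t p > 0" "det (M c p t) = 1 / normal_ratio t p ^ (CARD('n) + 2)"
proof -
  let ?U = "coord c ` dom_of c" and ?F = "x \<circ> coord_inv c" and ?G = "xt t \<circ> coord_inv c" and ?u = "coord c p"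
  have pos_t: "pos_definite (sff c (xt t) q)" if "q \<in> dom_of c" for q
    using orientation[OF zero_I t c that] pos[OF that] by (simp add: shifted_zero)
  interpret C: convex_patch ?U ?F
    by (rule convex_patch_chart[OF chart[OF c] c imm pos])
  interpret D: convex_patch ?U ?G
    by (rule convex_patch_chart[OF chart[OF c] c imm_t[OF t] pos_t])
  have u: "?u \<in> ?U" using p by blast
  have Y: "Y p = anormal ?F ?u" by (rule affine_normal_eq[OF lsc c pos p])
  have Z: "affine_normal \<A> (xt t) p = anormal ?G ?u" by (rule affine_normal_eq[OF lsc_t[OF t] c pos_t p])
  let ?d = "det (M c p t)"
  have d: "?d > 0" by (rule det_M_pos[OF t c p])
  have "rho ?G ?u = conormal ?G ?u \<bullet> affine_normal \<A> (xt t) p"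
    unfolding Z by (rule D.N_anormal[OF u, symmetric])
  also have "\<dots> = ?d * normal_ratio t p * (conormal ?F ?u \<bullet> Y p)"
    by (simp add: shifted_chart(2)[OF t c p] affine_normal_shifted[OF t])
  also have "conormal ?F ?u \<bullet> Y p = rho ?F ?u"
    unfolding Y by (rule C.N_anormal[OF u])
  finally have r: "rho ?G ?u = ?d * normal_ratio t p * rho ?F ?u" .
  then have "0 < (?d * rho ?F ?u) * normal_ratio t p" using D.rho_pos[OF u] by (simp add: mult_ac)
  then show fpos: "normal_ratio t p > 0"
    by (rule zero_less_mult_pos) (use d C.rho_pos[OF u] in simp)
  have "det (hess ?G ?u) = ?d ^ CARD('n) * (?d * det (hess ?F ?u))"
    using shifted_chart(3)[OF t c p]
    by (simp add: sff_eq_hess[OF chart[OF c] c imm p] sff_eq_hess[OF chart[OF c] c imm_t[OF t] p]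
        det_scaleR det_mul)
  moreover have "det (hess ?G ?u) = (?d * normal_ratio t p) ^ (CARD('n) + 2) * det (hess ?F ?u)"
    using D.rho_power[OF u] unfolding r power_mult_distrib C.rho_power[OF u] by simp
  ultimately have "(?d ^ CARD('n) * ?d * det (hess ?F ?u)) * (?d * normal_ratio t p ^ (CARD('n) + 2)) = (?d ^ CARD('n) * ?d * det (hess ?F ?u)) * 1"
    by (simp add: power_mult_distrib power_add power2_eq_square mult_ac)
  moreover have "?d ^ CARD('n) * ?d * det (hess ?F ?u) \<noteq> 0" using d C.det_pos[OF u] by simp
  ultimately have "?d * normal_ratio t p ^ (CARD('n) + 2) = 1" by (simp only: mult_cancel_left) simp
  then show "?d = 1 / normal_ratio t p ^ (CARD('n) + 2)" using fpos by (simp add: field_simps)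
qed

text \<open>\<open>D\<close> is a parameter so that one function can later be used at two points.
  With C = -B (I - t B)^(-1), the derivatives of Y have matrix \<open>C\<close> in the frame of
  \<open>xt t\<close>. Hence the shape operator is -f_t C, and tr C = D'/D.\<close>

lemma mean_curvature_eq:
  assumes t: "t \<in> I" and D: "\<And>s. s \<in> I \<Longrightarrow> D s = 1 / normal_ratio s p ^ (CARD('n) + 2)"
  shows "\<exists>D'. (D has_real_derivative D') (at t) \<and>
    affine_mean_curvature \<A> (xt t) p = - (normal_ratio t p * (D' / D t)) / real CARD('n)"
proof -
  \<comment> \<open>Oriented for \<open>xt t\<close>, as the definition of the mean curvature
    demands; \<open>orientation\<close> makes it oriented for \<open>x\<close> as well.\<close>
  define c where "c = oriented_chart \<A> (xt t) p"
  note c = oriented_chart_props[OF lsc_t[OF t], where p = p, folded c_def]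
  have pos: "pos_definite (sff c x q)" if "q \<in> dom_of c" for q
    using orientation[OF t zero_I c(1) that c(3)[OF that]] by (simp add: shifted_zero)
  let ?M = "M c p t" and ?B = "B c p"
  have det: "det (M c p s) = D s" if "s \<in> I" for s
    using det_M_eq(2)[OF that c(1,2) pos] D[OF that] by simp
  have "invertible ?M" using det_M_pos[OF t c(1,2)] by (simp add: invertible_det_nz)
  define C where "C = - ?B ** matrix_inv ?M"
  have CM: "C ** ?M = - ?B"
    unfolding C_def by (simp add: matrix_mul_assoc[symmetric] matrix_inv[OF \<open>invertible ?M\<close>])
  have "((\<lambda>s. det (M c p s)) has_real_derivative trace C * D t) (at t)"
    using has_derivative_det_pencil[OF CM] by (simp only: det[OF t])
  then have D': "(D has_real_derivative trace C * D t) (at t)"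
    by (rule has_field_derivative_transform_within_open[OF _ _ t det]) simp
  let ?F = "x \<circ> coord_inv c" and ?G = "xt t \<circ> coord_inv c" and ?u = "coord c p"
  have "shape_operator \<A> c (xt t) p = - normal_ratio t p *\<^sub>R C"
  proof (rule shape_operator_eqI[OF imm_t[OF t] c(1,2)])
    fix i
    \<comment> \<open>Constancy of the ratio over the whole manifold ensures that differentiating
      f_t Y yields no term along Y.\<close>
    have "affine_normal \<A> (xt t) \<circ> coord_inv c = (\<lambda>u. normal_ratio t p *\<^sub>R (Y \<circ> coord_inv c) u)"
      using normal_ratio_constant[OF t, of _ p] by (simp add: affine_normal_shifted[OF t] fun_eq_iff)
    then have "pd i (affine_normal \<A> (xt t) \<circ> coord_inv c) ?u = normal_ratio t p *\<^sub>R pd i (Y \<circ> coord_inv c) ?u"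
      using pd_scaleR[OF differentiable_const[of "normal_ratio t p"] affine_normal_any_chart(1)[OF lsc c(1) imageI[OF c(2)]], of i]
      by simp
    also have "\<dots> = normal_ratio t p *\<^sub>R (\<Sum>k\<in>UNIV. (C ** ?M) $ i $ k *\<^sub>R pd k ?F ?u)"
      unfolding CM pd_Y[OF c(1,2)] by (simp add: sum_negf)
    also have "(\<Sum>k\<in>UNIV. (C ** ?M) $ i $ k *\<^sub>R pd k ?F ?u) = (\<Sum>j\<in>UNIV. C $ i $ j *\<^sub>R pd j ?G ?u)"
    proof -
      have "(\<Sum>k\<in>UNIV. (C ** ?M) $ i $ k *\<^sub>R pd k ?F ?u) =
          (\<Sum>k\<in>UNIV. \<Sum>j\<in>UNIV. (C $ i $ j * ?M $ j $ k) *\<^sub>R pd k ?F ?u)"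
        unfolding matrix_matrix_mult_def by (simp add: scaleR_sum_left)
      also have "\<dots> = (\<Sum>j\<in>UNIV. \<Sum>k\<in>UNIV. (C $ i $ j * ?M $ j $ k) *\<^sub>R pd k ?F ?u)"
        by (rule sum.swap)
      also have "\<dots> = (\<Sum>j\<in>UNIV. C $ i $ j *\<^sub>R pd j ?G ?u)"
        by (simp only: shifted_chart(1)[OF t c(1,2)] scaleR_sum_right scaleR_scaleR)
      finally show ?thesis .
    qed
    finally show "pd i (affine_normal \<A> (xt t) \<circ> coord_inv c) ?u =
        - (\<Sum>j\<in>UNIV. (- normal_ratio t p *\<^sub>R C) $ i $ j *\<^sub>R pd j ?G ?u)"
      by (simp add: scaleR_sum_right sum_negf o_def)
  qed
  moreover have "trace (- normal_ratio t p *\<^sub>R C) = - normal_ratio t p * trace C"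
    by (simp add: trace_def sum_distrib_left sum_negf)
  moreover have "D t \<noteq> 0" using det[OF t] det_M_pos[OF t c(1,2)] by simp
  ultimately have "affine_mean_curvature \<A> (xt t) p = - (normal_ratio t p * (trace C * D t / D t)) / real CARD('n)"
    by (simp add: affine_mean_curvature_def c_def[symmetric])
  then show ?thesis using D' by blast
qed

lemma mean_curvature_constant:
  assumes t: "t \<in> I"
  shows "affine_mean_curvature \<A> (xt t) constant_on UNIV"
proof -
  fix o' :: 'm
  have "affine_mean_curvature \<A> (xt t) p = affine_mean_curvature \<A> (xt t) o'" for p
  proof -
    \<comment> \<open>Built from the ratio at the reference point \<open>o'\<close>. The ratio is
      the same at \<open>p\<close>, so this single function describes both points, and uniqueness of
      its derivative equates the curvatures.\<close>
    let ?D = "\<lambda>s. 1 / normal_ratio s o' ^ (CARD('n) + 2)"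
    have "\<And>s. s \<in> I \<Longrightarrow> ?D s = 1 / normal_ratio s p ^ (CARD('n) + 2)" using normal_ratio_constant[of _ o' p] by simp
    from mean_curvature_eq[OF t this] obtain D1 where D1: "(?D has_real_derivative D1) (at t)"
      "affine_mean_curvature \<A> (xt t) p = - (normal_ratio t p * (D1 / ?D t)) / real CARD('n)" by blast
    from mean_curvature_eq[OF t refl] obtain D2 where D2: "(?D has_real_derivative D2) (at t)"
      "affine_mean_curvature \<A> (xt t) o' = - (normal_ratio t o' * (D2 / ?D t)) / real CARD('n)" by blast
    show ?thesis using DERIV_unique[OF D1(1) D2(1)] D1(2) D2(2) normal_ratio_constant[OF t, of p o'] by simp
  qed
  then show ?thesis unfolding constant_on_def by blast
qed

end

theorem corollary1p3:
  fixes \<A> :: "('m::{t2_space, second_countable_topology}, 'n::finite) chart set"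
    and x :: "'m \<Rightarrow> real ^ 'n option"
  assumes "smooth_manifold \<A>"
    and "connected (UNIV :: 'm set)"
    and "nondegenerate \<A> x"
  shows "equiaffine_isoparametric \<A> x \<longleftrightarrow> among_equiaffine_parallel_family \<A> x"
proof
  assume "equiaffine_isoparametric \<A> x"
  then show "among_equiaffine_parallel_family \<A> x"
    unfolding equiaffine_isoparametric_def among_equiaffine_parallel_family_def by blast
next
  assume "among_equiaffine_parallel_family \<A> x"
  then obtain \<delta> where \<delta>: "\<delta> > 0" "equiaffine_parallel_family \<A> x \<delta>"
    unfolding among_equiaffine_parallel_family_def by blast
  interpret parallel_family \<A> x \<delta>
    by unfold_locales (fact assms(1) \<delta> assms(2))+
  show "equiaffine_isoparametric \<A> x"
    unfolding equiaffine_isoparametric_def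
    by (intro conjI exI[of _ \<delta>] ballI lsc \<delta> family mean_curvature_constant)
qed

end
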